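(* For all integers $n>2$, $$s_n\equiv -C_{n-1}+(-1)^n \pmod 3.$$
   Context: A block of a permutation $\pi$ of $\{1,\ldots,n\}$ is a nonempty set of consecutive positions whose set of values under $\pi$ is a set of consecutive integers. A permutation of length $n$ is simple if its only blocks are the singletons and $\{1,\ldots,n\}$. $s_n$ is the number of simple permutations of length $n$. $C_n=\frac{1}{n+1}\binom{2n}{n}$ is the $n$th Catalan number. *)

theory Defs
  imports Complex_Main "HOL-Combinatorics.Permutations" "HOL-Number_Theory.Cong"
begin

definition is_block :: "nat \<Rightarrow> (nat \<Rightarrow> nat) \<Rightarrow> nat set \<Rightarrow> bool" where
  "is_block n p I \<longleftrightarrow>
     I \<noteq> {} \<and> I \<subseteq> {1..n} \<and> (\<exists>a b. I = {a..b}) \<and> (\<exists>c d. p ` I = {c..d})"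

definition simple_perm :: "nat \<Rightarrow> (nat \<Rightarrow> nat) \<Rightarrow> bool" where
  "simple_perm n p \<longleftrightarrow>
     p permutes {1..n} \<and> (\<forall>I. is_block n p I \<longrightarrow> is_singleton I \<or> I = {1..n})"

(* Since "p permutes {1..n}" makes p the identity outside {1..n}, each permutation of {1..n}
   is counted exactly once and the set below is finite. *)
definition num_simple :: "nat \<Rightarrow> nat" where
  "num_simple n = card {p. simple_perm n p}"

(* The division is exact, see catalan_eq. *)
definition catalan :: "nat \<Rightarrow> nat" where
  "catalan n = ((2 * n) choose n) div (n + 1)"

lemma catalan_eq: "real (catalan n) = 1 / (real n + 1) * real ((2 * n) choose n)"
proof -
  have "Suc n * ((2 * n) choose Suc n) = (2 * n - n) * ((2 * n) choose n)"
    by (metis binomial_absorb_comp binomial_absorption)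
  hence "Suc n * ((2 * n) choose Suc n) = n * ((2 * n) choose n)"
    by simp
  hence "(n + 1) dvd n * ((2 * n) choose n)"
    by (metis Suc_eq_plus1 dvd_triv_left)
  moreover have "coprime (n + 1) n"
    by simp
  ultimately have "(n + 1) dvd ((2 * n) choose n)"
    using coprime_dvd_mult_right_iff by blast
  thus ?thesis
    unfolding catalan_def by (subst real_of_nat_div) (simp_all add: add.commute)
qed

end

theory Submission
  imports Defs "HOL-Computational_Algebra.Formal_Power_Series"
begin

text \<open>
  A permutation \<open>p\<close> of \<open>{1..n}\<close>, \<open>n \<ge> 2\<close>, is an inflation of a permutation \<open>t\<close> along a
  composition of \<open>n\<close> if \<open>p\<close> arises from \<open>t\<close> by replacing every entry by a block. If \<open>p\<close> is neither a
  direct sum nor a skew sum of two smaller permutations, then its maximal proper blocks are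
  disjoint, and contracting them gives a simple permutation of length at least three; this is the
  only way to write \<open>p\<close> as an inflation of such a permutation. If \<open>p\<close> is a direct or a skew sum,
  it is not both, and no such way exists. Exactly one of the three cases occurs for each \<open>p\<close>
  (\<open>decomposition_trichotomy\<close>).

  The number of inflations of a given \<open>t\<close> along a given composition is the product of the
  factorials of the part sizes (\<open>card_inflations\<close>), so all inflations of one \<open>t\<close> of length \<open>m\<close> are
  counted by the coefficients of \<open>F\<close> to the power \<open>m\<close>, where \<open>F\<close> is the series
  \<open>\<Sum>n\<ge>1. n! X^n\<close>. Direct sums are inflations of identity permutations and skew sums of
  decreasing ones; inclusion-exclusion over the places where \<open>p\<close> can be cut counts each of them
  once. Summing the trichotomy over all \<open>p\<close> gives
  \<open>n! = (\<Sum>m\<ge>3. s m * [X^n] F^m) + 2 * (\<Sum>m\<ge>2. (-1)^m * [X^n] F^m)\<close>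
  for \<open>n \<ge> 2\<close>. In other words, the series with coefficients \<open>-1\<close>, \<open>2\<close>, and \<open>s m + 2 * (-1)^m\<close> for
  \<open>m \<ge> 3\<close>, composed with \<open>F\<close>, is \<open>-X\<close> (\<open>enumeration_identity\<close>).

  Modulo 3 the series \<open>F\<close> is \<open>X - X^2\<close>, whose compositional inverse is the shifted Catalan series
  (\<open>catalan_compose_quad\<close>). Comparing coefficients, \<open>s m + 2 * (-1)^m\<close> is congruent to
  \<open>- C (m - 1)\<close>, and \<open>2\<close> is congruent to \<open>-1\<close>.
\<close>

section \<open>Permutations and the order of their values\<close>

text \<open>
  Every injective sequence has the relative order of a permutation, namely that of its ranks. This
  supplies the quotient of a permutation by its maximal blocks, as well as a first inflation of a
  given permutation.
\<close>
lemma standardization: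
  fixes q :: "nat \<Rightarrow> 'a::linorder"
  assumes inj: "inj_on q {1..m}"
  obtains t where "t permutes {1..m}"
    "\<And>i j. i \<in> {1..m} \<Longrightarrow> j \<in> {1..m} \<Longrightarrow> t i < t j \<longleftrightarrow> q i < q j"
proof -
  define r where "r i = card {j \<in> {1..m}. q j \<le> q i}" for i
  have less: "r i < r j" if "q i < q j" "j \<in> {1..m}" for i j
  proof -
    have "{l \<in> {1..m}. q l \<le> q i} \<subseteq> {l \<in> {1..m}. q l \<le> q j}"
      using that by auto
    moreover have "j \<in> {l \<in> {1..m}. q l \<le> q j} - {l \<in> {1..m}. q l \<le> q i}"
      using that by auto
    ultimately have "{l \<in> {1..m}. q l \<le> q i} \<subset> {l \<in> {1..m}. q l \<le> q j}"
      by blast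
    thus ?thesis
      unfolding r_def by (intro psubset_card_mono) auto
  qed
  have iff: "r i < r j \<longleftrightarrow> q i < q j" if "i \<in> {1..m}" "j \<in> {1..m}" for i j
  proof (cases "q i" "q j" rule: linorder_cases)
    case equal
    thus ?thesis by (simp add: r_def)
  qed (use less[of i j] less[of j i] that in auto)
  have "inj_on r {1..m}"
  proof (rule inj_onI)
    fix i j assume "i \<in> {1..m}" "j \<in> {1..m}" "r i = r j"
    thus "i = j"
      using iff[of i j] iff[of j i] inj_onD[OF inj, of i j] by (metis less_irrefl linorder_neqE)
  qed
  moreover have "r i \<in> {1..m}" if "i \<in> {1..m}" for i
  proof -
    have "r i \<le> card {1..m}"
      unfolding r_def by (intro card_mono) auto
    moreover have "0 < r i"
      unfolding r_def using that by (subst card_gt_0_iff) auto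
    ultimately show ?thesis by simp
  qed
  ultimately have "bij_betw r {1..m} {1..m}"
    by (metis bij_betw_def endo_inj_surj finite_atLeastAtMost image_subsetI)
  hence "bij_betw (\<lambda>i. if i \<in> {1..m} then r i else i) {1..m} {1..m}"
    by (subst bij_betw_cong[where g = r]) auto
  hence "(\<lambda>i. if i \<in> {1..m} then r i else i) permutes {1..m}"
    by (rule bij_imp_permutes) auto
  thus thesis
    by (rule that) (use iff in auto)
qed

lemma permutes_eq_rank:
  assumes "p permutes {1..m::nat}" "i \<in> {1..m}"
  shows "p i = card {j \<in> {1..m}. p j \<le> p i}"
proof -
  have "p ` {j \<in> {1..m}. p j \<le> p i} = {1..p i}"
  proof (intro equalityI subsetI)
    fix v assume v: "v \<in> {1..p i}"
    moreover have "p i \<in> {1..m}"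
      using assms by (simp only: permutes_in_image)
    ultimately have "v \<in> p ` {1..m}"
      using permutes_image[OF assms(1)] by auto
    thus "v \<in> p ` {j \<in> {1..m}. p j \<le> p i}"
      using v by auto
  next
    fix v assume "v \<in> p ` {j \<in> {1..m}. p j \<le> p i}"
    then obtain j where "j \<in> {1..m}" "p j \<le> p i" "v = p j" by auto
    thus "v \<in> {1..p i}"
      using permutes_in_image[OF assms(1), of j] by auto
  qed
  moreover have "inj_on p {j \<in> {1..m}. p j \<le> p i}"
    using permutes_inj_on[OF assms(1)] .
  ultimately show ?thesis
    by (metis card_atLeastAtMost card_image diff_Suc_1)
qed

lemma permutes_eqI_order:
  assumes p: "p permutes {1..m::nat}" and q: "q permutes {1..m}"
    and order: "\<And>i j. i \<in> {1..m} \<Longrightarrow> j \<in> {1..m} \<Longrightarrow> p i < p j \<Longrightarrow> q i < q j"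
  shows "p = q"
proof
  fix i
  show "p i = q i"
  proof (cases "i \<in> {1..m}")
    case True
    have "p j \<le> p i \<longleftrightarrow> q j \<le> q i" if "j \<in> {1..m}" for j
      using order[OF that True] order[OF True that] permutes_inj[OF p] permutes_inj[OF q]
      by (metis injD leD le_eq_less_or_eq leI)
    hence "{j \<in> {1..m}. p j \<le> p i} = {j \<in> {1..m}. q j \<le> q i}" by auto
    thus ?thesis
      using permutes_eq_rank[OF p True] permutes_eq_rank[OF q True] by simp
  next
    case False
    thus ?thesis using permutes_not_in[OF p] permutes_not_in[OF q] by simp
  qed
qed

section \<open>Compositions as sets of cuts\<close>

text \<open>
  A composition of \<open>n\<close> is encoded by the set \<open>S \<subseteq> {1..<n}\<close> of the positions after which
  \<open>{1..n}\<close> is cut; \<open>part S x\<close> is the number, counted from 1, of the part containing \<open>x\<close>. A composition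
  into \<open>m\<close> parts thus has \<open>Suc (card S) = m\<close>, and alternating sums over compositions become
  alternating sums over subsets.
\<close>
definition part :: "nat set \<Rightarrow> nat \<Rightarrow> nat" where
  "part S x = Suc (card (S \<inter> {..<x}))"

lemma part_mono: "x \<le> y \<Longrightarrow> part S x \<le> part S y"
  unfolding part_def by (intro Suc_le_mono[THEN iffD2] card_mono) auto

lemma part_Suc: "part S (Suc x) = (if x \<in> S then Suc (part S x) else part S x)"
proof -
  have "S \<inter> {..<Suc x} = (if x \<in> S then insert x (S \<inter> {..<x}) else S \<inter> {..<x})"
    by (auto simp: less_Suc_eq)
  thus ?thesis unfolding part_def by simp
qed

lemma part_less_iff: "part S x < part S y \<longleftrightarrow> (\<exists>s\<in>S. x \<le> s \<and> s < y)"
proof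
  assume "part S x < part S y"
  hence "\<not> S \<inter> {..<y} \<subseteq> S \<inter> {..<x}"
    unfolding part_def using card_mono[of "S \<inter> {..<x}" "S \<inter> {..<y}"] by auto
  thus "\<exists>s\<in>S. x \<le> s \<and> s < y"
    using linorder_not_less by auto
next
  assume "\<exists>s\<in>S. x \<le> s \<and> s < y"
  then obtain s where "s \<in> S" "x \<le> s" "s < y" by auto
  thus "part S x < part S y"
    using part_mono[of x s S] part_Suc[of S s] part_mono[of "Suc s" y S] by simp
qed

lemma part_less_imp_less: "part S x < part S y \<Longrightarrow> x < y"
  by (auto simp: part_less_iff)

lemma part_image:
  assumes "S \<subseteq> {1..<n}" "1 \<le> n"
  shows "part S ` {1..n} = {1..Suc (card S)}"
proof -
  have first: "part S 1 = 1"
    using assms by (auto simp: part_def)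
  have "S \<inter> {..<n} = S"
    using assms by auto
  hence last: "part S n = Suc (card S)"
    by (simp add: part_def)
  have "{1..part S y} \<subseteq> part S ` {1..y}" if "1 \<le> y" for y
    using that
  proof (induction y rule: dec_induct)
    case base
    thus ?case using first by auto
  next
    case (step y)
    have "{1..part S (Suc y)} \<subseteq> insert (part S (Suc y)) {1..part S y}"
      by (auto simp: part_Suc)
    also have "\<dots> \<subseteq> part S ` {1..Suc y}"
      using step.IH by (auto simp: atLeastAtMostSuc_conv)
    finally show ?case .
  qed
  from this[OF assms(2)] have "{1..Suc (card S)} \<subseteq> part S ` {1..n}"
    by (simp add: last)
  moreover have "part S ` {1..n} \<subseteq> {1..Suc (card S)}"
    using part_mono[of _ n S] last by (auto simp: part_def)
  ultimately show ?thesis by auto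
qed

text \<open>
  Only the relative order of entries in different parts is prescribed. For a permutation \<open>t\<close> it
  follows that the values of each part form an interval, so the sizes of the parts determine the values without being
  mentioned here.
\<close>
definition inflation :: "nat \<Rightarrow> nat set \<Rightarrow> (nat \<Rightarrow> nat) \<Rightarrow> (nat \<Rightarrow> nat) \<Rightarrow> bool" where
  "inflation n S t p \<longleftrightarrow> p permutes {1..n} \<and>
     (\<forall>x\<in>{1..n}. \<forall>y\<in>{1..n}. t (part S x) < t (part S y) \<longrightarrow> p x < p y)"

section \<open>Blocks\<close>

lemma interval_if_convex:
  fixes I :: "nat set"
  assumes "finite I" "I \<noteq> {}"
    and convex: "\<And>x y z. x \<in> I \<Longrightarrow> y \<in> I \<Longrightarrow> x < z \<Longrightarrow> z < y \<Longrightarrow> z \<in> I"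
  shows "\<exists>a b. I = {a..b}"
proof -
  have "I = {Min I..Max I}"
  proof (intro equalityI subsetI)
    fix z assume z: "z \<in> {Min I..Max I}"
    show "z \<in> I"
    proof (cases "z = Min I \<or> z = Max I")
      case True
      thus ?thesis using Min_in[OF assms(1,2)] Max_in[OF assms(1,2)] by (elim disjE) simp_all
    next
      case False
      hence "Min I < z" "z < Max I" using z by simp_all
      thus ?thesis by (rule convex[OF Min_in[OF assms(1,2)] Max_in[OF assms(1,2)]])
    qed
  next
    fix z assume "z \<in> I"
    thus "z \<in> {Min I..Max I}" using assms(1) by simp
  qed
  thus ?thesis by blast
qed

lemma blockI:
  assumes p: "p permutes {1..n}" and I: "I \<noteq> {}" "I \<subseteq> {1..n}"
    and convex: "\<And>x y z. x \<in> I \<Longrightarrow> y \<in> I \<Longrightarrow> x < z \<Longrightarrow> z < y \<Longrightarrow> z \<in> I"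
    and convex_values:
      "\<And>x y z. x \<in> I \<Longrightarrow> y \<in> I \<Longrightarrow> z \<in> {1..n} \<Longrightarrow> p x < p z \<Longrightarrow> p z < p y \<Longrightarrow> z \<in> I"
  shows "is_block n p I"
proof -
  have fin: "finite I" using I(2) by (rule finite_subset) simp
  have convex_image: "u \<in> p ` I" if "v \<in> p ` I" "w \<in> p ` I" "v < u" "u < w" for v w u
  proof -
    obtain x y where xy: "x \<in> I" "y \<in> I" "v = p x" "w = p y" using \<open>v \<in> _\<close> \<open>w \<in> _\<close> by auto
    have "x \<in> {1..n}" "y \<in> {1..n}" using xy I by auto
    hence "p x \<in> {1..n}" "p y \<in> {1..n}" by (simp_all only: permutes_in_image[OF p])
    hence "u \<in> {1..n}" using that xy by simp
    hence "u \<in> p ` {1..n}" by (simp only: permutes_image[OF p])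
    then obtain z where z: "z \<in> {1..n}" "u = p z" by auto
    hence "z \<in> I" using convex_values[OF xy(1,2) z(1)] that xy by simp
    thus ?thesis using z(2) by (rule rev_image_eqI)
  qed
  have "p ` I \<noteq> {}" using I(1) by blast
  hence "\<exists>c d. p ` I = {c..d}"
    by (rule interval_if_convex[OF finite_imageI[OF fin] _ convex_image])
  moreover have "\<exists>a b. I = {a..b}"
    using interval_if_convex[OF fin I(1) convex] .
  ultimately show ?thesis
    unfolding is_block_def using I by (intro conjI)
qed

lemma block_convex: "is_block n p I \<Longrightarrow> x \<in> I \<Longrightarrow> y \<in> I \<Longrightarrow> x < z \<Longrightarrow> z < y \<Longrightarrow> z \<in> I"
  by (auto simp: is_block_def)

lemma block_subset: "is_block n p I \<Longrightarrow> I \<subseteq> {1..n}"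
  by (simp add: is_block_def)

lemma block_convex_values:
  assumes p: "p permutes {1..n}" and I: "is_block n p I"
    and xy: "x \<in> I" "y \<in> I" "p x < p z" "p z < p y"
  shows "z \<in> I"
proof -
  obtain c d where cd: "p ` I = {c..d}"
    using I unfolding is_block_def by (elim conjE exE)
  have "p x \<in> {c..d}" "p y \<in> {c..d}"
    unfolding cd[symmetric] using xy(1,2) by (simp_all only: imageI)
  hence "p z \<in> {c..d}" using xy(3,4) by simp
  hence "p z \<in> p ` I" by (simp only: cd)
  thus ?thesis using permutes_inj[OF p] by (simp only: inj_image_mem_iff)
qed

text \<open>
  If two pairs of entries compared in opposite ways, one of the two sets would take a value strictly
  between two values of the other one, which is impossible for disjoint blocks.
\<close>
lemma blocks_separated:
  assumes p: "p permutes {1..n}" and I: "is_block n p I" and J: "is_block n p J"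
    and disjoint: "I \<inter> J = {}"
    and xy: "x \<in> I" "y \<in> J" "x' \<in> I" "y' \<in> J" "p x < p y"
  shows "p x' < p y'"
proof (rule ccontr)
  have neq: "p u \<noteq> p v" if "u \<in> I" "v \<in> J" for u v
    using that disjoint permutes_inj[OF p] by (metis disjoint_iff injD)
  assume "\<not> p x' < p y'"
  hence above: "p y' < p x'"
    using neq[OF xy(3,4)] by linarith
  show False
  proof (cases "p x < p y'")
    case True
    thus False using block_convex_values[OF p I xy(1,3) _ above] xy disjoint by blast
  next
    case False
    hence "p y' < p x" using neq[OF xy(1,4)] by linarith
    thus False using block_convex_values[OF p J xy(4,2) _ xy(5)] xy disjoint by blast
  qed
qed

text \<open>
  Used for positions, where \<open>f\<close> is the identity, and for values, where \<open>f\<close> is the permutation.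
\<close>
lemma convex_Un:
  fixes f :: "nat \<Rightarrow> nat"
  assumes I: "\<And>x y z. x \<in> I \<Longrightarrow> y \<in> I \<Longrightarrow> f x < f z \<Longrightarrow> f z < f y \<Longrightarrow> z \<in> I"
    and J: "\<And>x y z. x \<in> J \<Longrightarrow> y \<in> J \<Longrightarrow> f x < f z \<Longrightarrow> f z < f y \<Longrightarrow> z \<in> J"
    and c: "c \<in> I" "c \<in> J" and "inj f"
    and xy: "x \<in> I \<union> J" "y \<in> I \<union> J" "f x < f z" "f z < f y"
  shows "z \<in> I \<union> J"
proof (cases "f z" "f c" rule: linorder_cases)
  case less
  thus ?thesis using I[of x c z] J[of x c z] c xy by auto
next
  case equal
  thus ?thesis using c injD[OF \<open>inj f\<close>] by auto
next
  case greater
  thus ?thesis using I[of c y z] J[of c y z] c xy by auto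
qed

lemma block_Un:
  assumes p: "p permutes {1..n}" and I: "is_block n p I" and J: "is_block n p J"
    and c: "c \<in> I" "c \<in> J"
  shows "is_block n p (I \<union> J)"
proof (rule blockI[OF p])
  show "I \<union> J \<noteq> {}" "I \<union> J \<subseteq> {1..n}"
    using c block_subset[OF I] block_subset[OF J] by auto
next
  fix x y z assume xy: "x \<in> I \<union> J" "y \<in> I \<union> J" "x < z" "z < y"
  show "z \<in> I \<union> J"
    by (rule convex_Un[where f = "\<lambda>x. x", OF block_convex[OF I] block_convex[OF J] c _ xy]) simp_all
next
  fix x y z assume xy: "x \<in> I \<union> J" "y \<in> I \<union> J" "p x < p z" "p z < p y"
  show "z \<in> I \<union> J"
    by (rule convex_Un[OF block_convex_values[OF p I] block_convex_values[OF p J] c permutes_inj[OF p] xy])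
qed

text \<open>
  For \<open>R = (<)\<close> these are the places where \<open>p\<close> splits as a direct sum, for \<open>R = (>)\<close> those where
  it splits as a skew sum.
\<close>
definition cuts :: "(nat \<Rightarrow> nat \<Rightarrow> bool) \<Rightarrow> nat \<Rightarrow> (nat \<Rightarrow> nat) \<Rightarrow> nat set" where
  "cuts R n p = {s \<in> {1..<n}. \<forall>x\<in>{1..s}. \<forall>y\<in>{Suc s..n}. R (p x) (p y)}"

lemma block_with_end_points:
  assumes "is_block n p I" "1 \<in> I" "n \<in> I"
  shows "I = {1..n}"
proof (intro equalityI subsetI)
  fix z assume "z \<in> {1..n}"
  hence "z = 1 \<or> z = n \<or> 1 < z \<and> z < n" by auto
  thus "z \<in> I" using block_convex[OF assms] assms(2,3) by blast
qed (use block_subset[OF assms(1)] in blast)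

text \<open>
  The block \<open>J\<close> is a final segment. The values before \<open>J\<close> all lie on the same side of the
  values on \<open>J\<close>: the positions before \<open>J\<close> belong to the block \<open>I\<close>, and values on both sides would
  force \<open>J \<subseteq> I\<close>.
\<close>
lemma cut_if_overlapping_blocks_cover:
  assumes p: "p permutes {1..n}" and I: "is_block n p I" and J: "is_block n p J"
    and proper: "I \<noteq> {1..n}" "J \<noteq> {1..n}" and cover: "I \<union> J = {1..n}"
    and first: "1 \<in> I"
  shows "cuts (<) n p \<noteq> {} \<or> cuts (>) n p \<noteq> {}"
proof -
  have "1 \<in> {1..n}" using first cover by blast
  hence "1 \<le> n" by simp
  have "n \<notin> I" using block_with_end_points[OF I first] proper by blast
  moreover have "n \<in> I \<union> J" unfolding cover using \<open>1 \<le> n\<close> by simp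
  ultimately have last: "n \<in> J" by blast
  have not_first: "1 \<notin> J" using block_with_end_points[OF J _ last] proper by blast
  define b where "b = Min J"
  have fin: "finite J" using block_subset[OF J] by (rule finite_subset) simp
  have b: "b \<in> J" unfolding b_def using Min_in[OF fin] last by blast
  have J_iff: "z \<in> J \<longleftrightarrow> b \<le> z" if "z \<in> {1..n}" for z
  proof
    assume "b \<le> z"
    hence "z = b \<or> z = n \<or> b < z \<and> z < n" using that by auto
    thus "z \<in> J" using block_convex[OF J b last] last b by blast
  next
    assume "z \<in> J"
    thus "b \<le> z" unfolding b_def using fin by (rule Min_le[rotated])
  qed
  have "b \<in> {1..n}" using b block_subset[OF J] by blast
  moreover have "b \<noteq> 1" using b not_first by blast
  ultimately have s: "b - 1 \<in> {1..<n}" and "1 \<le> b" by auto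
  have left: "x \<in> {1..n}" "x \<notin> J" "x \<in> I" if "x \<in> {1..b - 1}" for x
  proof -
    show "x \<in> {1..n}" using that \<open>b \<in> {1..n}\<close> by auto
    moreover have "\<not> b \<le> x" using that by auto
    ultimately show "x \<notin> J" using J_iff by blast
    thus "x \<in> I" using cover \<open>x \<in> {1..n}\<close> by blast
  qed
  have right: "y \<in> J" if "y \<in> {Suc (b - 1)..n}" for y
    using J_iff[of y] that \<open>1 \<le> b\<close> by auto
  have neq: "p x \<noteq> p y" if "x \<notin> J" "y \<in> J" for x y
    using that permutes_inj[OF p] by (metis injD)
  have below_all: "p x < p y" if "x \<notin> J" "y \<in> J" "z \<in> J" "p x < p z" for x y z
    using block_convex_values[OF p J that(2,3) _ that(4)] neq[OF that(1,2)] that(1)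
    by (metis linorder_neqE_nat)
  have same_side: "p x' < p b" if x: "x \<in> {1..b - 1}" "x' \<in> {1..b - 1}" "p x < p b" for x x'
  proof (rule ccontr)
    assume "\<not> p x' < p b"
    hence above: "p y < p x'" if "y \<in> J" for y
      using below_all[OF left(2)[OF x(2)] b that] neq[OF left(2)[OF x(2)] that]
      by (metis linorder_neqE_nat)
    have "y \<in> I" if "y \<in> J" for y
      using block_convex_values[OF p I left(3)[OF x(1)] left(3)[OF x(2)] _ above[OF that]]
        below_all[OF left(2)[OF x(1)] that b x(3)] by blast
    thus False using cover proper by blast
  qed
  show ?thesis
  proof (cases "p 1 < p b")
    case True
    have "p x < p y" if xy: "x \<in> {1..b - 1}" "y \<in> {Suc (b - 1)..n}" for x y
    proof -
      have "p x < p b" using same_side[OF _ xy(1) True] s by simp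
      thus ?thesis using below_all[OF left(2)[OF xy(1)] right[OF xy(2)] b] by blast
    qed
    hence "b - 1 \<in> cuts (<) n p" unfolding cuts_def using s by blast
    thus ?thesis by blast
  next
    case False
    have "p x > p y" if xy: "x \<in> {1..b - 1}" "y \<in> {Suc (b - 1)..n}" for x y
    proof -
      have "\<not> p x < p b" using same_side[OF xy(1), of 1] False s by auto
      thus ?thesis
        using below_all[OF left(2)[OF xy(1)] b right[OF xy(2)]] neq[OF left(2)[OF xy(1)] right[OF xy(2)]]
        by (metis linorder_neqE_nat)
    qed
    hence "b - 1 \<in> cuts (>) n p" unfolding cuts_def using s by blast
    thus ?thesis by blast
  qed
qed

section \<open>Substitution decomposition\<close>

lemma inflation_permutes: "inflation n S t p \<Longrightarrow> p permutes {1..n}"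
  by (simp add: inflation_def)

lemma inflationD:
  "inflation n S t p \<Longrightarrow> x \<in> {1..n} \<Longrightarrow> y \<in> {1..n} \<Longrightarrow> t (part S x) < t (part S y) \<Longrightarrow> p x < p y"
  by (simp add: inflation_def)

lemma inflation_le:
  assumes "inflation n S t p" "x \<in> {1..n}" "y \<in> {1..n}" "p x < p y"
  shows "t (part S x) \<le> t (part S y)"
  using inflationD[OF assms(1,3,2)] assms(4) by force

text \<open>
  Blocks correspond in both directions: a block of \<open>t\<close> inflates to a block of \<open>p\<close>, and the parts
  that meet a block of \<open>p\<close> form a block of \<open>t\<close>.
\<close>
lemma block_vimage_part:
  assumes infl: "inflation n S t p" and S: "S \<subseteq> {1..<n}" "1 \<le> n"
    and J: "is_block (Suc (card S)) t J" and t: "t permutes {1..Suc (card S)}"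
  shows "is_block n p {x \<in> {1..n}. part S x \<in> J}"
proof -
  have conv: "j \<in> J" if "i \<in> J" "k \<in> J" "i \<le> j" "j \<le> k" for i j k
    using block_convex[OF J that(1,2), of j] that by (metis le_neq_implies_less)
  have conv_values: "j \<in> J" if "i \<in> J" "k \<in> J" "t i \<le> t j" "t j \<le> t k" for i j k
    using block_convex_values[OF t J that(1,2), of j] that permutes_inj[OF t]
    by (metis injD le_neq_implies_less)
  obtain j where j: "j \<in> J" using J by (auto simp: is_block_def)
  moreover have "j \<in> part S ` {1..n}"
    using j block_subset[OF J] part_image[OF S] by blast
  ultimately have ne: "{x \<in> {1..n}. part S x \<in> J} \<noteq> {}" by blast
  show ?thesis
  proof (rule blockI[OF inflation_permutes[OF infl] ne])
    fix x y z
    assume xy: "x \<in> {x \<in> {1..n}. part S x \<in> J}" "y \<in> {x \<in> {1..n}. part S x \<in> J}" "x < z" "z < y"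
    have "part S x \<le> part S z" "part S z \<le> part S y"
      using xy by (intro part_mono; simp)+
    thus "z \<in> {x \<in> {1..n}. part S x \<in> J}"
      using conv[of "part S x" "part S y"] xy by auto
  next
    fix x y z
    assume xy: "x \<in> {x \<in> {1..n}. part S x \<in> J}" "y \<in> {x \<in> {1..n}. part S x \<in> J}"
      "z \<in> {1..n}" "p x < p z" "p z < p y"
    have "t (part S x) \<le> t (part S z)" "t (part S z) \<le> t (part S y)"
      using xy by (auto intro: inflation_le[OF infl])
    thus "z \<in> {x \<in> {1..n}. part S x \<in> J}"
      using conv_values[of "part S x" "part S y"] xy by auto
  qed auto
qed

lemma block_image_part:
  assumes infl: "inflation n S t p" and S: "S \<subseteq> {1..<n}" "1 \<le> n"
    and I: "is_block n p I" and t: "t permutes {1..Suc (card S)}"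
  shows "is_block (Suc (card S)) t (part S ` I)"
proof (rule blockI[OF t])
  show "part S ` I \<noteq> {}" using I by (simp add: is_block_def)
  show "part S ` I \<subseteq> {1..Suc (card S)}"
    using block_subset[OF I] part_image[OF S] by blast
next
  fix i k j assume ik: "i \<in> part S ` I" "k \<in> part S ` I" "i < j" "j < k"
  then obtain x y where xy: "x \<in> I" "y \<in> I" "i = part S x" "k = part S y" by blast
  have "x \<in> {1..n}" "y \<in> {1..n}" using xy block_subset[OF I] by blast+
  hence "i \<in> {1..Suc (card S)}" "k \<in> {1..Suc (card S)}"
    using part_image[OF S] xy by blast+
  hence "j \<in> part S ` {1..n}" using ik part_image[OF S] by simp
  then obtain z where z: "z \<in> {1..n}" "j = part S z" by blast
  have "x < z" "z < y" using ik xy z part_less_imp_less by simp_all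
  hence "z \<in> I" by (rule block_convex[OF I xy(1,2)])
  thus "j \<in> part S ` I" using z by blast
next
  fix i k j assume ik: "i \<in> part S ` I" "k \<in> part S ` I" "j \<in> {1..Suc (card S)}" "t i < t j" "t j < t k"
  then obtain x y where xy: "x \<in> I" "y \<in> I" "i = part S x" "k = part S y" by blast
  have "x \<in> {1..n}" "y \<in> {1..n}" using xy block_subset[OF I] by blast+
  moreover obtain z where z: "z \<in> {1..n}" "j = part S z"
    using ik(3) part_image[OF S] by blast
  ultimately have "p x < p z" "p z < p y"
    using inflationD[OF infl] ik(4,5) xy by simp_all
  hence "z \<in> I" by (rule block_convex_values[OF inflation_permutes[OF infl] I xy(1,2)])
  thus "j \<in> part S ` I" using z by blast
qed

lemma simple_permutes: "simple_perm m t \<Longrightarrow> t permutes {1..m}"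
  by (simp add: simple_perm_def)

text \<open>
  An entry that is first or last and also minimal or maximal leaves a block when it is removed.
\<close>
lemma simple_no_extreme_corner:
  assumes t: "simple_perm m t" and m: "3 \<le> m" and l: "l = 1 \<or> l = m" "t l = 1 \<or> t l = m"
  shows False
proof -
  note perm = simple_permutes[OF t]
  have l_in: "l \<in> {1..m}" using l m by auto
  have card: "2 \<le> card ({1..m} - {l})" using l_in m by simp
  have two: "\<not> is_singleton ({1..m} - {l})"
    using card unfolding is_singleton_altdef by linarith
  have ne: "{1..m} - {l} \<noteq> {}"
    using card by (metis card.empty not_numeral_le_zero)
  have "is_block m t ({1..m} - {l})"
  proof (rule blockI[OF perm ne])
    fix x y z assume xy: "x \<in> {1..m} - {l}" "y \<in> {1..m} - {l}" "x < z" "z < y"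
    thus "z \<in> {1..m} - {l}" using l(1) by auto
  next
    fix x y z assume xy: "x \<in> {1..m} - {l}" "y \<in> {1..m} - {l}" "z \<in> {1..m}" "t x < t z" "t z < t y"
    have "t x \<in> {1..m}" "t y \<in> {1..m}"
      using xy permutes_in_image[OF perm] by blast+
    hence "t z \<noteq> t l" using l(2) xy(4,5) by auto
    thus "z \<in> {1..m} - {l}" using xy(3) by auto
  qed auto
  moreover have "{1..m} - {l} \<noteq> {1..m}" using l_in by blast
  ultimately show False using t two unfolding simple_perm_def by blast
qed

text \<open>
  The parts that meet \<open>I\<close> form a block of the simple permutation \<open>t\<close>, so if there are two of them,
  \<open>I\<close> meets every part. By convexity \<open>I\<close> then contains all parts except possibly those that are
  first or last, and all parts except possibly those of least or greatest value. A part outside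
  \<open>I\<close> would therefore be a corner of \<open>t\<close>, and a simple permutation of length at least three has none.
\<close>
lemma proper_block_in_part:
  assumes infl: "inflation n S t p" and S: "S \<subseteq> {1..<n}" "1 \<le> n"
    and simple: "simple_perm (Suc (card S)) t" "2 \<le> card S"
    and I: "is_block n p I" "I \<noteq> {1..n}" and xy: "x \<in> I" "y \<in> I"
  shows "part S x = part S y"
proof (rule ccontr)
  assume neq: "part S x \<noteq> part S y"
  define m where "m = Suc (card S)"
  note t = simple_permutes[OF simple(1)] and p = inflation_permutes[OF infl]
  note t' = t[folded m_def]
  have "\<not> is_singleton (part S ` I)"
    using neq xy by (metis image_eqI is_singleton_def singletonD)
  hence meets_all: "part S ` I = {1..m}"
    using block_image_part[OF infl S I(1) t] simple(1) unfolding simple_perm_def m_def by blast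
  obtain z where z: "z \<in> {1..n}" "z \<notin> I" using I block_subset[OF I(1)] by blast
  define l where "l = part S z"
  have l: "l \<in> {1..m}" using z part_image[OF S] unfolding l_def m_def by blast
  have "l = 1 \<or> l = m"
  proof (rule ccontr)
    assume "\<not> (l = 1 \<or> l = m)"
    hence lt: "1 < l" "l < m" using l by auto
    have "1 \<in> part S ` I" "m \<in> part S ` I" unfolding meets_all by (simp_all add: m_def)
    then obtain u v where uv: "u \<in> I" "part S u = 1" "v \<in> I" "part S v = m" by force
    have "u < z" "z < v"
      using lt uv(2,4) part_less_imp_less[of S u z] part_less_imp_less[of S z v]
      by (simp_all add: l_def)
    thus False using block_convex[OF I(1) uv(1,3)] z by blast
  qed
  moreover have "t l = 1 \<or> t l = m"
  proof (rule ccontr)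
    assume "\<not> (t l = 1 \<or> t l = m)"
    moreover have "t l \<in> {1..m}" using l by (simp only: permutes_in_image[OF t'])
    ultimately have lt: "1 < t l" "t l < m" by auto
    have "1 \<in> t ` part S ` I" "m \<in> t ` part S ` I"
      unfolding meets_all permutes_image[OF t'] by (simp_all add: m_def)
    then obtain u v where uv: "u \<in> I" "t (part S u) = 1" "v \<in> I" "t (part S v) = m" by force
    have "u \<in> {1..n}" "v \<in> {1..n}" using uv block_subset[OF I(1)] by blast+
    hence "p u < p z" "p z < p v"
      using inflationD[OF infl _ z(1), of u] inflationD[OF infl z(1), of v] uv lt
      by (simp_all add: l_def)
    thus False using block_convex_values[OF p I(1) uv(1,3)] z by blast
  qed
  ultimately show False
    using simple_no_extreme_corner[OF simple(1)] simple(2) unfolding m_def by auto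
qed

lemma singleton_is_block: "i \<in> {1..m} \<Longrightarrow> is_block m t {i}"
  unfolding is_block_def by (metis atLeastAtMost_singleton empty_subsetI image_empty image_insert insert_not_empty insert_subset)

text \<open>
  The part of \<open>S\<close> that contains \<open>x\<close> and \<open>y\<close> is a proper block of \<open>p\<close>, hence lies in a part of \<open>T\<close>.
\<close>
lemma inflation_simple_le:
  assumes infl: "inflation n S t p" "inflation n T u p"
    and S: "S \<subseteq> {1..<n}" and T: "T \<subseteq> {1..<n}" and n: "1 \<le> n"
    and simple: "simple_perm (Suc (card S)) t" "2 \<le> card S" "simple_perm (Suc (card T)) u" "2 \<le> card T"
    and xy: "x \<in> {1..n}" "y \<in> {1..n}" "part S x = part S y"
  shows "part T x = part T y"
proof -
  define I where "I = {z \<in> {1..n}. part S z \<in> {part S x}}"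
  have "part S x \<in> {1..Suc (card S)}" using part_image[OF S n] xy by blast
  hence "is_block n p I"
    unfolding I_def
    by (intro block_vimage_part[OF infl(1) S n _ simple_permutes[OF simple(1)]] singleton_is_block)
  moreover have "I \<noteq> {1..n}"
  proof
    assume "I = {1..n}"
    hence "{1..Suc (card S)} \<subseteq> {part S x}"
      unfolding part_image[OF S n, symmetric] I_def by blast
    hence "card {1..Suc (card S)} \<le> card {part S x}" by (intro card_mono) auto
    thus False using simple(2) by simp
  qed
  ultimately show ?thesis
    using proper_block_in_part[OF infl(2) T n simple(3,4), of I x y] xy unfolding I_def by simp
qed

lemma inflation_simple_unique:
  assumes infl: "inflation n S t p" "inflation n T u p"
    and S: "S \<subseteq> {1..<n}" and T: "T \<subseteq> {1..<n}" and n: "1 \<le> n"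
    and simple: "simple_perm (Suc (card S)) t" "2 \<le> card S" "simple_perm (Suc (card T)) u" "2 \<le> card T"
  shows "S = T \<and> t = u"
proof -
  have "s \<in> S \<longleftrightarrow> s \<in> T" if "s \<in> {1..<n}" for s
  proof -
    have "s \<in> {1..n}" "Suc s \<in> {1..n}" using that by auto
    hence "part S s = part S (Suc s) \<longleftrightarrow> part T s = part T (Suc s)"
      using inflation_simple_le[OF infl S T n simple]
        inflation_simple_le[OF infl(2,1) T S n simple(3,4,1,2)] by blast
    thus ?thesis by (simp add: part_Suc split: if_splits)
  qed
  hence ST: "S = T" using S T by blast
  have "t = u"
  proof (rule permutes_eqI_order)
    show t: "t permutes {1..Suc (card S)}" and u: "u permutes {1..Suc (card S)}"
      using simple ST by (auto dest: simple_permutes)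
    fix i j assume ij: "i \<in> {1..Suc (card S)}" "j \<in> {1..Suc (card S)}" "t i < t j"
    obtain x y where xy: "x \<in> {1..n}" "y \<in> {1..n}" "i = part S x" "j = part S y"
      using ij(1,2) unfolding part_image[OF S n, symmetric] by blast
    have "p x < p y" using inflationD[OF infl(1) xy(1,2)] ij(3) xy by simp
    hence "u i \<le> u j" using inflation_le[OF infl(2) xy(1,2)] xy ST by simp
    moreover have "i \<noteq> j" using ij(3) by blast
    hence "u i \<noteq> u j" using permutes_inj[OF u] by (metis injD)
    ultimately show "u i < u j" by simp
  qed
  thus ?thesis using ST by blast
qed

lemma cut_blocks:
  assumes p: "p permutes {1..n}" and s: "s \<in> cuts R n p" and R: "R = (<) \<or> R = (>)"
  shows "is_block n p {1..s}" "is_block n p {Suc s..n}"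
proof -
  have s_in: "1 \<le> s" "s < n" and sep: "\<And>x y. x \<in> {1..s} \<Longrightarrow> y \<in> {Suc s..n} \<Longrightarrow> R (p x) (p y)"
    using s by (auto simp: cuts_def)
  show "is_block n p {1..s}"
  proof (rule blockI[OF p])
    fix x y z assume xy: "x \<in> {1..s}" "y \<in> {1..s}" "z \<in> {1..n}" "p x < p z" "p z < p y"
    show "z \<in> {1..s}"
    proof (rule ccontr)
      assume "z \<notin> {1..s}"
      hence "z \<in> {Suc s..n}" using xy(3) by simp
      hence "R (p x) (p z)" "R (p y) (p z)" using sep xy(1,2) by blast+
      thus False using R xy(4,5) by auto
    qed
  qed (use s_in in auto)
  show "is_block n p {Suc s..n}"
  proof (rule blockI[OF p])
    fix x y z assume xy: "x \<in> {Suc s..n}" "y \<in> {Suc s..n}" "z \<in> {1..n}" "p x < p z" "p z < p y"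
    show "z \<in> {Suc s..n}"
    proof (rule ccontr)
      assume "z \<notin> {Suc s..n}"
      hence "z \<in> {1..s}" using xy(3) by simp
      hence "R (p z) (p x)" "R (p z) (p y)" using sep xy(1,2) by blast+
      thus False using R xy(4,5) by auto
    qed
  qed (use s_in in auto)
qed

text \<open>
  Both sides of a cut are proper blocks, so each would lie in one part, leaving at most two parts.
\<close>
lemma inflation_simple_no_cuts:
  assumes infl: "inflation n S t p" and S: "S \<subseteq> {1..<n}" "1 \<le> n"
    and simple: "simple_perm (Suc (card S)) t" "2 \<le> card S" and R: "R = (<) \<or> R = (>)"
  shows "cuts R n p = {}"
proof (rule ccontr)
  assume "cuts R n p \<noteq> {}"
  then obtain s where s: "s \<in> cuts R n p" by blast
  hence s_in: "1 \<le> s" "s < n" by (auto simp: cuts_def)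
  note blocks = cut_blocks[OF inflation_permutes[OF infl] s R]
  have "part S x \<in> {part S 1, part S n}" if "x \<in> {1..n}" for x
  proof (cases "x \<le> s")
    case True
    have "part S x = part S 1"
      by (rule proper_block_in_part[OF infl S simple blocks(1)]) (use s_in that True in auto)
    thus ?thesis by blast
  next
    case False
    have "part S x = part S n"
      by (rule proper_block_in_part[OF infl S simple blocks(2)]) (use s_in that False in auto)
    thus ?thesis by blast
  qed
  hence "{1..Suc (card S)} \<subseteq> {part S 1, part S n}"
    unfolding part_image[OF S, symmetric] by blast
  hence "card {1..Suc (card S)} \<le> card {part S 1, part S n}"
    by (intro card_mono) auto
  also have "\<dots> \<le> 2" by (simp add: card_insert_if)
  finally show False using simple(2) by simp
qed

text \<open>
  The union of two proper blocks through \<open>x\<close> is again a block, and it is proper because otherwise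
  \<open>p\<close> would have a cut. So a maximal proper block through \<open>x\<close> contains all the others.
\<close>
lemma exists_maximal_proper_block:
  assumes p: "p permutes {1..n}" and n: "2 \<le> n"
    and no_cuts: "cuts (<) n p = {}" "cuts (>) n p = {}" and x: "x \<in> {1..n}"
  shows "\<exists>M. is_block n p M \<and> M \<noteq> {1..n} \<and> x \<in> M \<and>
    (\<forall>I. is_block n p I \<and> I \<noteq> {1..n} \<and> x \<in> I \<longrightarrow> I \<subseteq> M)"
proof -
  define \<B> where "\<B> = {I. is_block n p I \<and> I \<noteq> {1..n} \<and> x \<in> I}"
  have "\<B> \<subseteq> Pow {1..n}" unfolding \<B>_def using block_subset by blast
  hence "finite \<B>" by (rule finite_subset) simp
  moreover have "{x} \<noteq> {1..n}"
  proof
    assume "{x} = {1..n}"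
    hence "card {x} = card {1..n}" by (rule arg_cong)
    thus False using n by simp
  qed
  hence "{x} \<in> \<B>" unfolding \<B>_def using singleton_is_block[OF x] by blast
  ultimately obtain M where M: "M \<in> \<B>" "\<And>I. I \<in> \<B> \<Longrightarrow> M \<subseteq> I \<Longrightarrow> M = I"
    using finite_has_maximal[of \<B>] by blast
  have "I \<subseteq> M" if I: "I \<in> \<B>" for I
  proof -
    have b: "is_block n p I" "is_block n p M" "x \<in> I" "x \<in> M" "I \<noteq> {1..n}" "M \<noteq> {1..n}"
      using I M(1) by (simp_all add: \<B>_def)
    have "I \<union> M \<noteq> {1..n}"
    proof
      assume cover: "I \<union> M = {1..n}"
      moreover have "1 \<in> {1..n}" using n by simp
      ultimately have "1 \<in> I \<or> 1 \<in> M" by blast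
      thus False
        using cut_if_overlapping_blocks_cover[OF p b(1,2,5,6) cover]
          cut_if_overlapping_blocks_cover[OF p b(2,1,6,5)] cover no_cuts
        by (metis Un_commute)
    qed
    hence "I \<union> M \<in> \<B>" unfolding \<B>_def using block_Un[OF p b(1,2,3,4)] b(3) by blast
    thus ?thesis using M(2) by blast
  qed
  thus ?thesis using M(1) unfolding \<B>_def by blast
qed

text \<open>
  The maximal proper blocks \<open>M x\<close> partition \<open>{1..n}\<close> into intervals; let \<open>S\<close> cut between them and
  let \<open>t\<close> be the pattern formed by one entry from each. A block of \<open>t\<close> with two elements inflates to
  a block of \<open>p\<close> that meets two maximal proper blocks, so it is not proper. A single part would not
  be proper, and two parts would give a cut.
\<close>
lemma exists_inflation_simple:
  assumes p: "p permutes {1..n}" and n: "2 \<le> n"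
    and no_cuts: "cuts (<) n p = {}" "cuts (>) n p = {}"
  shows "\<exists>S t. S \<subseteq> {1..<n} \<and> 2 \<le> card S \<and> simple_perm (Suc (card S)) t \<and> inflation n S t p"
proof -
  have "\<forall>x\<in>{1..n}. \<exists>M. is_block n p M \<and> M \<noteq> {1..n} \<and> x \<in> M \<and>
    (\<forall>I. is_block n p I \<and> I \<noteq> {1..n} \<and> x \<in> I \<longrightarrow> I \<subseteq> M)"
    using exists_maximal_proper_block[OF assms] by blast
  from bchoice[OF this] obtain M where M: "\<forall>x\<in>{1..n}. is_block n p (M x) \<and> M x \<noteq> {1..n} \<and> x \<in> M x \<and>
    (\<forall>I. is_block n p I \<and> I \<noteq> {1..n} \<and> x \<in> I \<longrightarrow> I \<subseteq> M x)" by (elim exE)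
  have block: "\<And>x. x \<in> {1..n} \<Longrightarrow> is_block n p (M x)"
    and proper: "\<And>x. x \<in> {1..n} \<Longrightarrow> M x \<noteq> {1..n}"
    and self: "\<And>x. x \<in> {1..n} \<Longrightarrow> x \<in> M x"
    and maximal: "\<And>x I. x \<in> {1..n} \<Longrightarrow> is_block n p I \<Longrightarrow> I \<noteq> {1..n} \<Longrightarrow> x \<in> I \<Longrightarrow> I \<subseteq> M x"
    using M by simp_all
  have M_eq: "M y = M x" if "x \<in> {1..n}" "y \<in> M x" for x y
  proof -
    have y: "y \<in> {1..n}" using that block block_subset by blast
    have "M x \<subseteq> M y" using maximal[OF y block proper] that by blast
    moreover from this have "M y \<subseteq> M x" using maximal[OF _ block proper] that y self by blast
    ultimately show ?thesis by blast
  qed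
  define S where "S = {s \<in> {1..<n}. M s \<noteq> M (Suc s)}"
  have S: "S \<subseteq> {1..<n}" "1 \<le> n" using n by (auto simp: S_def)
  have finS: "finite S" using S(1) by (rule finite_subset) simp
  have part_eq_le: "part S x = part S y \<longleftrightarrow> M x = M y" if xy: "x \<in> {1..n}" "y \<in> {1..n}" "x \<le> y" for x y
  proof
    assume eq: "part S x = part S y"
    have same: "M s = M (Suc s)" if "x \<le> s" "s < y" for s
    proof -
      have "s \<notin> S" using that eq part_less_iff[of S x y] by auto
      thus ?thesis using that xy by (simp add: S_def)
    qed
    from \<open>x \<le> y\<close> show "M x = M y"
      using same by (induction y rule: dec_induct) simp_all
  next
    assume eq: "M x = M y"
    have "s \<notin> S" if s: "x \<le> s" "s < y" for s
    proof -
      have mem: "x \<in> M x" "y \<in> M x" using self[OF xy(1)] self[OF xy(2)] eq by simp_all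
      have "z \<in> M x" if "x \<le> z" "z \<le> y" for z
      proof -
        have "z = x \<or> z = y \<or> x < z \<and> z < y" using that by linarith
        thus ?thesis using block_convex[OF block[OF xy(1)] mem] mem by blast
      qed
      note M_eq[OF xy(1) this]
      from this[of s] this[of "Suc s"] have "M s = M (Suc s)" using s by simp
      thus ?thesis by (simp add: S_def)
    qed
    hence "\<not> part S x < part S y" unfolding part_less_iff by blast
    thus "part S x = part S y" using part_mono[OF xy(3), of S] by simp
  qed
  have part_eq: "part S x = part S y \<longleftrightarrow> M x = M y" if "x \<in> {1..n}" "y \<in> {1..n}" for x y
    using part_eq_le[of x y] part_eq_le[of y x] that by (metis nat_le_linear)
  define m where "m = Suc (card S)"
  have "\<forall>j\<in>{1..m}. \<exists>x. x \<in> {1..n} \<and> part S x = j"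
    unfolding m_def part_image[OF S, symmetric] by blast
  from bchoice[OF this] obtain r
    where "\<forall>j\<in>{1..m}. r j \<in> {1..n} \<and> part S (r j) = j" by (elim exE)
  hence r: "\<And>j. j \<in> {1..m} \<Longrightarrow> r j \<in> {1..n}" "\<And>j. j \<in> {1..m} \<Longrightarrow> part S (r j) = j"
    by simp_all
  have part_in: "part S x \<in> {1..m}" if "x \<in> {1..n}" for x
    unfolding m_def part_image[OF S, symmetric] using that by (rule imageI)
  have "inj_on (\<lambda>j. p (r j)) {1..m}"
  proof (rule inj_onI)
    fix i j assume ij: "i \<in> {1..m}" "j \<in> {1..m}" and eq: "p (r i) = p (r j)"
    from eq have "r i = r j" by (rule injD[OF permutes_inj[OF p]])
    hence "part S (r i) = part S (r j)" by (rule arg_cong)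
    thus "i = j" unfolding r(2)[OF ij(1)] r(2)[OF ij(2)] .
  qed
  then obtain t where t: "t permutes {1..m}"
    and t_less: "\<And>i j. i \<in> {1..m} \<Longrightarrow> j \<in> {1..m} \<Longrightarrow> t i < t j \<longleftrightarrow> p (r i) < p (r j)"
    using standardization by blast
  have infl: "inflation n S t p"
    unfolding inflation_def
  proof (intro conjI ballI impI p)
    fix x y assume xy: "x \<in> {1..n}" "y \<in> {1..n}" and less: "t (part S x) < t (part S y)"
    have "part S x \<noteq> part S y" using less by auto
    hence "M x \<noteq> M y" using part_eq[OF xy] by simp
    hence disjoint: "M x \<inter> M y = {}" using M_eq xy by blast
    have rep: "r (part S z) \<in> M z" if "z \<in> {1..n}" for z
    proof -
      note in_n = r(1)[OF part_in[OF that]]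
      have "M (r (part S z)) = M z"
        using part_eq[OF in_n that] r(2)[OF part_in[OF that]] by blast
      thus ?thesis using self[OF in_n] by blast
    qed
    have "p (r (part S x)) < p (r (part S y))"
      using less t_less[OF part_in part_in] xy by blast
    thus "p x < p y"
      by (rule blocks_separated[OF p block[OF xy(1)] block[OF xy(2)] disjoint
            rep[OF xy(1)] rep[OF xy(2)] self[OF xy(1)] self[OF xy(2)]])
  qed
  have simple: "simple_perm m t"
    unfolding simple_perm_def
  proof (intro conjI t allI impI)
    fix J assume J: "is_block m t J"
    show "is_singleton J \<or> J = {1..m}"
    proof (cases "is_singleton J")
      case False
      have "J \<noteq> {}" using J by (simp add: is_block_def)
      then obtain i where i: "i \<in> J" by blast
      obtain j where j: "j \<in> J" "j \<noteq> i"
        using False i unfolding is_singleton_def by blast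
      have ij: "i \<in> {1..m}" "j \<in> {1..m}" using i j block_subset[OF J] by blast+
      \<comment> \<open>\<open>J\<close> inflates to a block that contains representatives of two maximal proper blocks.\<close>
      define I where "I = {x \<in> {1..n}. part S x \<in> J}"
      have I: "is_block n p I"
        unfolding I_def using block_vimage_part[OF infl S J[unfolded m_def] t[unfolded m_def]] .
      have rI: "r i \<in> I" "r j \<in> I" 
        unfolding I_def using r(1)[OF ij(1)] r(1)[OF ij(2)] r(2)[OF ij(1)] r(2)[OF ij(2)] i j(1)
        by simp_all
      have "I = {1..n}"
      proof (rule ccontr)
        assume "I \<noteq> {1..n}"
        hence "r j \<in> M (r i)" using maximal[OF r(1)[OF ij(1)] I _ rI(1)] rI(2) by blast
        hence "M (r j) = M (r i)" by (rule M_eq[OF r(1)[OF ij(1)]])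
        hence "part S (r j) = part S (r i)" using part_eq[OF r(1)[OF ij(2)] r(1)[OF ij(1)]] by blast
        thus False unfolding r(2)[OF ij(1)] r(2)[OF ij(2)] using j(2) by blast
      qed
      hence "{1..m} \<subseteq> J" unfolding m_def part_image[OF S, symmetric] I_def by blast
      thus ?thesis using block_subset[OF J] by blast
    qed simp
  qed
  have "card S \<noteq> 0"
  proof
    assume "card S = 0"
    hence "S = {}" using finS by simp
    moreover have one: "1 \<in> {1..n}" using n by simp
    ultimately have "M x = M 1" if "x \<in> {1..n}" for x
      using part_eq[OF that one] by (simp add: part_def)
    hence "{1..n} \<subseteq> M 1" using self by blast
    with one show False using proper block block_subset by blast
  qed
  moreover have "card S \<noteq> 1"
  proof
    assume one: "card S = 1"
    then obtain s where s: "S = {s}" by (auto simp: card_1_singleton_iff)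
    have s_in: "s \<in> {1..<n}" using S s by blast
    have part: "part S x = 1" "part S y = 2" if "x \<in> {1..s}" "y \<in> {Suc s..n}" for x y
    proof -
      have "{s} \<inter> {..<x} = {}" "{s} \<inter> {..<y} = {s}" using that by auto
      thus "part S x = 1" "part S y = 2" by (simp_all add: part_def s)
    qed
    have sub: "x \<in> {1..n}" "y \<in> {1..n}" if "x \<in> {1..s}" "y \<in> {Suc s..n}" for x y
      using that s_in by auto
    have "t 1 \<noteq> t 2" by (simp add: inj_eq[OF permutes_inj[OF t]])
    then consider "t 1 < t 2" | "t 2 < t 1" by linarith
    thus False
    proof cases
      case 1
      have "p x < p y" if "x \<in> {1..s}" "y \<in> {Suc s..n}" for x y
        using inflationD[OF infl sub[OF that]] part[OF that] 1 by simp
      hence "s \<in> cuts (<) n p" unfolding cuts_def using s_in by blast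
      thus False using no_cuts by blast
    next
      case 2
      have "p y < p x" if "x \<in> {1..s}" "y \<in> {Suc s..n}" for x y
        using inflationD[OF infl sub(2)[OF that] sub(1)[OF that]] part[OF that] 2 by simp
      hence "s \<in> cuts (>) n p" unfolding cuts_def using s_in by blast
      thus False using no_cuts by blast
    qed
  qed
  ultimately have "2 \<le> card S" by linarith
  thus ?thesis using S infl simple unfolding m_def by blast
qed

definition simple_decompositions :: "nat \<Rightarrow> (nat \<Rightarrow> nat) \<Rightarrow> (nat set \<times> (nat \<Rightarrow> nat)) set" where
  "simple_decompositions n p =
     {(S, t). S \<subseteq> {1..<n} \<and> 2 \<le> card S \<and> simple_perm (Suc (card S)) t \<and> inflation n S t p}"

lemma decomposition_trichotomy:
  assumes p: "p permutes {1..n}" and n: "2 \<le> n"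
  shows "card (simple_decompositions n p) + of_bool (cuts (<) n p \<noteq> {}) + of_bool (cuts (>) n p \<noteq> {}) = 1"
proof (cases "cuts (<) n p = {} \<and> cuts (>) n p = {}")
  case True
  then obtain S t where "(S, t) \<in> simple_decompositions n p"
    using exists_inflation_simple[OF assms] unfolding simple_decompositions_def by blast
  moreover have "d = e" if "d \<in> simple_decompositions n p" "e \<in> simple_decompositions n p" for d e
    using that inflation_simple_unique[of n _ _ p] n unfolding simple_decompositions_def
    by (elim CollectE case_prodE conjE) simp
  ultimately have "simple_decompositions n p = {(S, t)}" by blast
  thus ?thesis using True by simp
next
  case False
  hence "simple_decompositions n p = {}"
    using inflation_simple_no_cuts[of n _ _ p] n unfolding simple_decompositions_def by fastforce
  moreover have "\<not> (cuts (<) n p \<noteq> {} \<and> cuts (>) n p \<noteq> {})"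
  proof
    \<comment> \<open>The two kinds of cuts order the first and the last entry differently.\<close>
    assume "cuts (<) n p \<noteq> {} \<and> cuts (>) n p \<noteq> {}"
    then obtain s s' where "s \<in> cuts (<) n p" "s' \<in> cuts (>) n p" by blast
    hence "p 1 < p n" "p n < p 1" unfolding cuts_def by simp_all
    thus False by simp
  qed
  ultimately show ?thesis using False by auto
qed

section \<open>Counting the inflations along a given set of cuts\<close>

text \<open>
  As in the count of all permutations, a new point \<open>a\<close> can be sent to any point \<open>b\<close> of its fibre,
  and composing with the transposition of \<open>a\<close> and \<open>b\<close>, which preserves the fibres, leaves a
  permutation of the old points.
\<close>
lemma card_fibre_preserving_permutations:
  assumes "finite A" "finite I" "g ` A \<subseteq> I"
  shows "card {p. p permutes A \<and> (\<forall>x\<in>A. g (p x) = g x)} = (\<Prod>i\<in>I. fact (card {x\<in>A. g x = i}))"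
  using assms(1,3)
proof (induction A rule: finite_induct)
  case empty
  have "{p. p permutes {} \<and> (\<forall>x\<in>{}. g (p x) = g x)} = {id}"
    by auto
  thus ?case by simp
next
  case (insert a F)
  define Q where "Q A = {p. p permutes A \<and> (\<forall>x\<in>A. g (p x) = g x)}" for A
  define B where "B = {b \<in> insert a F. g b = g a}"
  have swap: "g (transpose a b x) = g x" if "b \<in> B" for b x
    using that by (auto simp: B_def transpose_def)
  have "bij_betw (\<lambda>(b, p). transpose a b \<circ> p) (B \<times> Q F) (Q (insert a F))"
    unfolding bij_betw_def
  proof (intro conjI equalityI subsetI)
    show "inj_on (\<lambda>(b, p). transpose a b \<circ> p) (B \<times> Q F)"
    proof (rule inj_onI, clarify)
      fix b p c q
      assume *: "p \<in> Q F" "q \<in> Q F" and eq: "transpose a b \<circ> p = transpose a c \<circ> q"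
      have "p a = a" "q a = a"
        using * insert.hyps by (auto simp: Q_def permutes_not_in)
      hence "b = c" using fun_cong[OF eq, of a] by simp
      moreover have "p = transpose a b \<circ> (transpose a b \<circ> p)" by (simp add: fun_eq_iff)
      moreover have "q = transpose a b \<circ> (transpose a b \<circ> q)" by (simp add: fun_eq_iff)
      ultimately show "b = c \<and> p = q" using eq by metis
    qed
  next
    fix p' assume "p' \<in> (\<lambda>(b, p). transpose a b \<circ> p) ` (B \<times> Q F)"
    then obtain b p where bp: "b \<in> B" "p \<in> Q F" "p' = transpose a b \<circ> p" by auto
    have "p permutes insert a F" using bp(2) by (auto simp: Q_def intro: permutes_subset)
    moreover have "transpose a b permutes insert a F"
      using bp(1) by (intro permutes_swap_id) (auto simp: B_def)
    moreover have "g (p x) = g x" if "x \<in> insert a F" for x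
      using bp(2) that insert.hyps by (auto simp: Q_def permutes_not_in)
    ultimately show "p' \<in> Q (insert a F)"
      using bp swap[OF bp(1)] by (auto simp: Q_def intro: permutes_compose)
  next
    fix p assume p: "p \<in> Q (insert a F)"
    hence perm: "p permutes insert a F" by (simp add: Q_def)
    have "p a \<in> insert a F" by (simp only: permutes_in_image[OF perm] insertI1)
    hence b: "p a \<in> B" using p by (simp add: Q_def B_def)
    have "transpose a (p a) \<circ> p permutes F"
      by (rule permutes_insert_lemma[OF perm])
    moreover have "g ((transpose a (p a) \<circ> p) x) = g x" if "x \<in> F" for x
      using p that swap[OF b] by (simp add: Q_def)
    ultimately have "(p a, transpose a (p a) \<circ> p) \<in> B \<times> Q F"
      using b by (simp add: Q_def)
    moreover have "p = (\<lambda>(b, p). transpose a b \<circ> p) (p a, transpose a (p a) \<circ> p)"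
      by (simp add: fun_eq_iff)
    ultimately show "p \<in> (\<lambda>(b, p). transpose a b \<circ> p) ` (B \<times> Q F)"
      by (rule rev_image_eqI)
  qed
  hence "card (Q (insert a F)) = card B * card (Q F)"
    by (simp add: bij_betw_same_card[symmetric] card_cartesian_product)
  also have "card B = Suc (card {x\<in>F. g x = g a})"
  proof -
    have "B = insert a {x\<in>F. g x = g a}" unfolding B_def by auto
    thus ?thesis using insert.hyps by simp
  qed
  also have "card (Q F) = (\<Prod>i\<in>I. fact (card {x\<in>F. g x = i}))"
    using insert.IH insert.prems by (simp add: Q_def)
  also have "\<dots> = fact (card {x\<in>F. g x = g a}) * (\<Prod>i\<in>I - {g a}. fact (card {x\<in>F. g x = i}))"
    using insert.prems assms(2) by (intro prod.remove) auto
  also have "Suc (card {x\<in>F. g x = g a}) * \<dots> =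
      fact (Suc (card {x\<in>F. g x = g a})) * (\<Prod>i\<in>I - {g a}. fact (card {x\<in>F. g x = i}))"
    by (simp add: algebra_simps)
  also have "Suc (card {x\<in>F. g x = g a}) = card {x\<in>insert a F. g x = g a}"
  proof -
    have "{x\<in>insert a F. g x = g a} = insert a {x\<in>F. g x = g a}" by auto
    thus ?thesis using insert.hyps by simp
  qed
  also have "(\<Prod>i\<in>I - {g a}. fact (card {x\<in>F. g x = i})) =
      (\<Prod>i\<in>I - {g a}. fact (card {x\<in>insert a F. g x = i}) :: nat)"
    by (intro prod.cong refl arg_cong[where f = "\<lambda>X. fact (card X)"]) auto
  also have "fact (card {x\<in>insert a F. g x = g a}) * \<dots> = (\<Prod>i\<in>I. fact (card {x\<in>insert a F. g x = i}))"
    using insert.prems assms(2) by (intro prod.remove[symmetric]) auto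
  finally show ?case by (simp add: Q_def)
qed

text \<open>
  Suppose \<open>k x < k y\<close> and let \<open>v\<close> be the common value. Under \<open>p\<close> all entries of class at least \<open>k y\<close>
  have values above \<open>v\<close>, so there are at most \<open>n - v\<close> of them; under \<open>q\<close> all others have values
  below \<open>v\<close>, so there are at most \<open>v - 1\<close> of these. Together this is less than \<open>n\<close>.
\<close>
lemma same_value_same_class:
  fixes k :: "nat \<Rightarrow> nat"
  assumes p: "p permutes {1..n}" and q: "q permutes {1..n}"
    and kp: "\<And>x y. x \<in> {1..n} \<Longrightarrow> y \<in> {1..n} \<Longrightarrow> k x < k y \<Longrightarrow> p x < p y"
    and kq: "\<And>x y. x \<in> {1..n} \<Longrightarrow> y \<in> {1..n} \<Longrightarrow> k x < k y \<Longrightarrow> q x < q y"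
    and xy: "x \<in> {1..n}" "y \<in> {1..n}" "p x = q y"
  shows "k y \<le> k x"
proof (rule ccontr)
  assume less: "\<not> k y \<le> k x"
  \<comment> \<open>\<open>U\<close> is mapped above the common value by \<open>p\<close>, its complement below it by \<open>q\<close>.\<close>
  define U where "U = {z \<in> {1..n}. k y \<le> k z}"
  have "p ` U \<subseteq> {Suc (p x)..n}"
  proof
    fix v assume "v \<in> p ` U"
    then obtain z where z: "z \<in> {1..n}" "k y \<le> k z" "v = p z" by (auto simp: U_def)
    have "p x < p z" using kp[OF xy(1) z(1)] less z(2) by simp
    moreover have "p z \<in> {1..n}" using z(1) by (simp only: permutes_in_image[OF p])
    ultimately show "v \<in> {Suc (p x)..n}" using z(3) by simp
  qed
  hence "card (p ` U) \<le> n - p x"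
    using card_mono[of "{Suc (p x)..n}" "p ` U"] by simp
  moreover have "q ` ({1..n} - U) \<subseteq> {1..<q y}"
  proof
    fix v assume "v \<in> q ` ({1..n} - U)"
    then obtain z where "z \<in> {1..n}" "z \<notin> U" "v = q z" by blast
    hence z: "z \<in> {1..n}" "k z < k y" "v = q z" by (simp_all add: U_def not_le)
    have "q z < q y" using kq[OF z(1) xy(2) z(2)] .
    moreover have "q z \<in> {1..n}" using z(1) by (simp only: permutes_in_image[OF q])
    ultimately show "v \<in> {1..<q y}" using z(3) by simp
  qed
  hence "card (q ` ({1..n} - U)) \<le> q y - 1"
    using card_mono[of "{1..<q y}" "q ` ({1..n} - U)"] by simp
  moreover have "card (p ` U) = card U" "card (q ` ({1..n} - U)) = card ({1..n} - U)"
    by (rule card_image, rule permutes_inj_on[OF p], rule card_image, rule permutes_inj_on[OF q])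
  moreover have "U \<subseteq> {1..n}" by (auto simp: U_def)
  hence "card U \<le> n" "card ({1..n} - U) = n - card U"
    using card_mono[of "{1..n}" U] by (simp_all add: card_Diff_subset finite_subset)
  moreover have "p x \<in> {1..n}" using xy(1) by (simp only: permutes_in_image[OF p])
  hence "1 \<le> p x" "p x \<le> n" by simp_all
  ultimately show False using xy(3) by linarith
qed

definition class_weight :: "nat \<Rightarrow> nat set \<Rightarrow> nat" where
  "class_weight n S = (\<Prod>i\<in>{1..Suc (card S)}. fact (card {x\<in>{1..n}. part S x = i}))"

text \<open>
  Once one inflation \<open>p0\<close> is known, the others are the \<open>p0 \<circ> r\<close> for the permutations \<open>r\<close> that move
  entries only within their parts.
\<close>
lemma card_inflations:
  assumes S: "S \<subseteq> {1..<n}" "1 \<le> n" and t: "t permutes {1..Suc (card S)}"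
  shows "card {p. inflation n S t p} = class_weight n S"
proof -
  \<comment> \<open>Ranking the entries by part value and then by position yields one inflation.\<close>
  define q where "q x = t (part S x) * Suc n + x" for x
  have q_less: "q x < q y" if "y \<in> {1..n}" "x \<in> {1..n}" "t (part S x) < t (part S y)" for x y
  proof -
    have "q x < Suc (t (part S x)) * Suc n" using that by (simp add: q_def)
    also have "\<dots> \<le> t (part S y) * Suc n" using that(3) by (intro mult_right_mono) simp_all
    also have "\<dots> \<le> q y" by (simp add: q_def)
    finally show ?thesis .
  qed
  have "inj_on q {1..n}"
  proof (rule inj_onI)
    fix x y assume xy: "x \<in> {1..n}" "y \<in> {1..n}" and eq: "q x = q y"
    hence "t (part S x) = t (part S y)"
      using q_less[OF xy(2,1)] q_less[OF xy] by (metis less_irrefl linorder_neqE_nat)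
    thus "x = y" using eq by (simp add: q_def)
  qed
  then obtain p0 where p0: "p0 permutes {1..n}"
    and p0_less: "\<And>i j. i \<in> {1..n} \<Longrightarrow> j \<in> {1..n} \<Longrightarrow> p0 i < p0 j \<longleftrightarrow> q i < q j"
    using standardization by blast
  have less0: "p0 x < p0 y" if "x \<in> {1..n}" "y \<in> {1..n}" "t (part S x) < t (part S y)" for x y
    using p0_less[OF that(1,2)] q_less[OF that(2,1,3)] by blast
  define R where "R = {r. r permutes {1..n} \<and> (\<forall>x\<in>{1..n}. part S (r x) = part S x)}"
  have "{p. inflation n S t p} = (\<lambda>r. p0 \<circ> r) ` R"
  proof (intro equalityI subsetI)
    fix p assume "p \<in> {p. inflation n S t p}"
    hence infl: "inflation n S t p" by simp
    note p = inflation_permutes[OF infl]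
    define r where "r = inv p0 \<circ> p"
    have r: "r permutes {1..n}"
      unfolding r_def using p permutes_inv[OF p0] by (rule permutes_compose)
    have p_eq: "p = p0 \<circ> r"
      unfolding r_def using permutes_inverses(1)[OF p0] by (simp add: fun_eq_iff)
    have "part S (r x) = part S x" if x: "x \<in> {1..n}" for x
    proof -
      have rx: "r x \<in> {1..n}" using x by (simp only: permutes_in_image[OF r])
      have eq: "p x = p0 (r x)" by (simp add: p_eq)
      have "t (part S (r x)) \<le> t (part S x)"
        by (rule same_value_same_class[OF p p0 inflationD[OF infl] less0 x rx eq])
      moreover have "t (part S x) \<le> t (part S (r x))"
        by (rule same_value_same_class[OF p0 p less0 inflationD[OF infl] rx x eq[symmetric]])
      ultimately have "t (part S (r x)) = t (part S x)" by (rule antisym)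
      thus ?thesis by (rule injD[OF permutes_inj[OF t]])
    qed
    hence "r \<in> R" using r by (simp add: R_def)
    thus "p \<in> (\<lambda>r. p0 \<circ> r) ` R" using p_eq by blast
  next
    fix p assume "p \<in> (\<lambda>r. p0 \<circ> r) ` R"
    then obtain r where r: "r permutes {1..n}" "\<forall>x\<in>{1..n}. part S (r x) = part S x" "p = p0 \<circ> r"
      by (auto simp: R_def)
    have "p x < p y" if xy: "x \<in> {1..n}" "y \<in> {1..n}" "t (part S x) < t (part S y)" for x y
    proof -
      have "r x \<in> {1..n}" "r y \<in> {1..n}" using xy by (simp_all only: permutes_in_image[OF r(1)])
      thus ?thesis using less0[of "r x" "r y"] xy r(2,3) by simp
    qed
    thus "p \<in> {p. inflation n S t p}"
      using permutes_compose[OF r(1) p0] r(3) by (simp add: inflation_def)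
  qed
  moreover have "inj_on (\<lambda>r. p0 \<circ> r) R"
  proof (rule inj_onI)
    fix r r' assume "p0 \<circ> r = p0 \<circ> r'"
    hence "inv p0 \<circ> (p0 \<circ> r) = inv p0 \<circ> (p0 \<circ> r')" by (rule arg_cong)
    thus "r = r'" by (simp only: o_assoc permutes_inv_o(2)[OF p0] id_o)
  qed
  ultimately have "card {p. inflation n S t p} = card R"
    by (simp add: card_image)
  also have "\<dots> = class_weight n S"
    unfolding R_def class_weight_def
    by (rule card_fibre_preserving_permutations) (simp_all only: part_image[OF S] finite_atLeastAtMost order_refl)
  finally show ?thesis .
qed

section \<open>The generating function of the class weights\<close>

definition fact_fps :: "int fps" where
  "fact_fps = Abs_fps (\<lambda>n. if n = 0 then 0 else fact n)"

lemma part_insert: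
  assumes "S \<subseteq> {1..<k}"
  shows "part (insert k S) x = (if x \<le> k then part S x else Suc (Suc (card S)))"
proof -
  have "finite S" "k \<notin> S" using assms finite_subset by auto
  show ?thesis
  proof (cases "x \<le> k")
    case True
    hence "insert k S \<inter> {..<x} = S \<inter> {..<x}" by auto
    thus ?thesis using True by (simp add: part_def)
  next
    case False
    hence "insert k S \<inter> {..<x} = insert k S" using assms by auto
    thus ?thesis using False \<open>finite S\<close> \<open>k \<notin> S\<close> by (simp add: part_def)
  qed
qed

lemma class_weight_insert:
  assumes S: "S \<subseteq> {1..<k}" and k: "1 \<le> k" "k < n"
  shows "class_weight n (insert k S) = class_weight k S * fact (n - k)"
proof -
  have card: "card (insert k S) = Suc (card S)"
    using S finite_subset[OF S] by (subst card_insert_disjoint) auto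
  define m where "m = Suc (card S)"
  have le: "part S x \<le> m" for x
    unfolding part_def m_def using finite_subset[OF S] by (intro Suc_le_mono[THEN iffD2] card_mono) auto
  have "{x\<in>{1..n}. part (insert k S) x = Suc m} = {Suc k..n}"
    using k le by (auto simp: part_insert[OF S] m_def[symmetric] Suc_le_eq not_le dest: le_less_trans)
       (metis le not_less_eq_eq order_refl not_le)+
  moreover have "{x\<in>{1..n}. part (insert k S) x = i} = {x\<in>{1..k}. part S x = i}" if "i \<in> {1..m}" for i
    using that k by (auto simp: part_insert[OF S] m_def[symmetric] split: if_splits)
  ultimately show ?thesis
    unfolding class_weight_def card m_def[symmetric]
    by (simp add: prod.nat_ivl_Suc' mult.commute)
qed

text \<open>
  Cutting off the last part, which starts after the largest element of the cut set, corresponds to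
  one factor of \<open>fact_fps\<close>.
\<close>
lemma sum_class_weight:
  assumes "1 \<le> n"
  shows "(\<Sum>S | S \<subseteq> {1..<n} \<and> card S = m. int (class_weight n S)) = fps_nth (fact_fps ^ Suc m) n"
  using assms
proof (induction m arbitrary: n)
  case 0
  have "{S. S \<subseteq> {1..<n} \<and> card S = 0} = {{}}"
    by (auto dest: finite_subset)
  moreover have "{x \<in> {1..n}. part {} x = 1} = {1..n}"
    by (auto simp: part_def)
  hence "class_weight n {} = fact n"
    by (simp add: class_weight_def)
  ultimately show ?case using 0 by (simp add: fact_fps_def)
next
  case (Suc m)
  define A where "A n m = {S. S \<subseteq> {1..<n} \<and> card S = m}" for n m :: nat
  have fin: "finite (A n m)" for n m
    by (rule finite_subset[of _ "Pow {1..<n}"]) (auto simp: A_def)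
  have fin_elem: "finite S" if "S \<in> A n m" for S n m
    using that by (auto simp: A_def intro: finite_subset)
  have bij: "bij_betw (\<lambda>(k, S). insert k S) (SIGMA k:{1..<n}. A k m) (A n (Suc m))"
  \<comment> \<open>The inverse splits off the largest cut.\<close>
  proof (rule bij_betwI[where g = "\<lambda>S. (Max S, S - {Max S})"])
    show "(\<lambda>(k, S). insert k S) \<in> (SIGMA k:{1..<n}. A k m) \<rightarrow> A n (Suc m)"
    proof (clarify)
      fix k S assume k: "k \<in> {1..<n}" and S: "S \<in> A k m"
      have "k \<notin> S" using S by (auto simp: A_def)
      thus "insert k S \<in> A n (Suc m)" using k S fin_elem[OF S] by (auto simp: A_def)
    qed
    show "(\<lambda>S. (Max S, S - {Max S})) \<in> A n (Suc m) \<rightarrow> (SIGMA k:{1..<n}. A k m)"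
    proof
      fix S assume S: "S \<in> A n (Suc m)"
      hence "S \<noteq> {}" by (auto simp: A_def)
      hence Max: "Max S \<in> S" "\<And>x. x \<in> S \<Longrightarrow> x \<le> Max S" using fin_elem[OF S] by simp_all
      have "S - {Max S} \<subseteq> {1..<Max S}"
        using Max S by (force simp: A_def le_less)
      thus "(Max S, S - {Max S}) \<in> (SIGMA k:{1..<n}. A k m)"
        using Max(1) S fin_elem[OF S] by (auto simp: A_def)
    qed
    fix kS assume "kS \<in> (SIGMA k:{1..<n}. A k m)"
    then obtain k S where kS: "kS = (k, S)" "S \<in> A k m" by auto
    have "Max (insert k S) = k"
      using kS fin_elem[OF kS(2)] by (intro Max_eqI) (auto simp: A_def)
    moreover have "k \<notin> S" using kS by (auto simp: A_def)
    ultimately show "(Max (case kS of (k, S) \<Rightarrow> insert k S), (case kS of (k, S) \<Rightarrow> insert k S) - {Max (case kS of (k, S) \<Rightarrow> insert k S)}) = kS"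
      using kS by auto
  next
    fix S assume S: "S \<in> A n (Suc m)"
    hence "S \<noteq> {}" by (auto simp: A_def)
    hence "Max S \<in> S" using fin_elem[OF S] by simp
    thus "(case (Max S, S - {Max S}) of (k, S) \<Rightarrow> insert k S) = S" by auto
  qed
  have "(\<Sum>S\<in>A n (Suc m). int (class_weight n S)) =
      (\<Sum>(k, S)\<in>(SIGMA k:{1..<n}. A k m). int (class_weight n (insert k S)))"
    by (subst sum.reindex_bij_betw[OF bij, symmetric]) (simp add: case_prod_unfold)
  also have "\<dots> = (\<Sum>k\<in>{1..<n}. \<Sum>S\<in>A k m. int (class_weight n (insert k S)))"
    by (rule sum.Sigma[symmetric]) (use fin in auto)
  also have "\<dots> = (\<Sum>k\<in>{1..<n}. fps_nth (fact_fps ^ Suc m) k * fact (n - k))"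
  proof (rule sum.cong[OF refl])
    fix k assume k: "k \<in> {1..<n}"
    have "(\<Sum>S\<in>A k m. int (class_weight n (insert k S))) =
        (\<Sum>S\<in>A k m. int (class_weight k S) * fact (n - k))"
      using k by (intro sum.cong refl) (simp add: A_def class_weight_insert of_nat_fact)
    thus "(\<Sum>S\<in>A k m. int (class_weight n (insert k S))) = fps_nth (fact_fps ^ Suc m) k * fact (n - k)"
      using Suc.IH[of k] k by (simp add: A_def sum_distrib_right[symmetric])
  qed
  also have "\<dots> = (\<Sum>k\<in>{0..n}. fps_nth (fact_fps ^ Suc m) k * fps_nth fact_fps (n - k))"
  proof (rule sum.mono_neutral_cong_left)
    show "\<forall>k\<in>{0..n} - {1..<n}. fps_nth (fact_fps ^ Suc m) k * fps_nth fact_fps (n - k) = 0"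
    proof
      fix k assume "k \<in> {0..n} - {1..<n}"
      hence "k = 0 \<or> k = n" by auto
      thus "fps_nth (fact_fps ^ Suc m) k * fps_nth fact_fps (n - k) = 0"
        by (auto simp: fact_fps_def fps_nth_power_0)
    qed
  qed (auto simp: fact_fps_def)
  also have "\<dots> = fps_nth (fact_fps ^ Suc (Suc m)) n"
    by (simp only: power_Suc2[of fact_fps "Suc m"] fps_mult_nth)
  finally show ?case by (simp add: A_def)
qed

section \<open>The enumeration identity\<close>

text \<open>
  Two positions lie in different parts exactly if an element of \<open>S\<close> separates them. So inflating the
  identity along \<open>S\<close> means that every element of \<open>S\<close> is a place where \<open>p\<close> splits.
\<close>
lemma inflation_id_iff:
  assumes p: "p permutes {1..n}" and S: "S \<subseteq> {1..<n}"
  shows "inflation n S id p \<longleftrightarrow> S \<subseteq> cuts (<) n p"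
proof
  assume infl: "inflation n S id p"
  show "S \<subseteq> cuts (<) n p"
  proof
    fix s assume s: "s \<in> S"
    hence s_in: "s \<in> {1..<n}" using S by blast
    have "p x < p y" if "x \<in> {1..s}" "y \<in> {Suc s..n}" for x y
    proof -
      have "x \<le> s" "s < y" "x \<in> {1..n}" "y \<in> {1..n}" using that s_in by simp_all
      thus ?thesis using inflationD[OF infl, of x y] part_less_iff[of S x y] s by auto
    qed
    thus "s \<in> cuts (<) n p" using s_in unfolding cuts_def by blast
  qed
next
  assume sub: "S \<subseteq> cuts (<) n p"
  have "p x < p y" if xy: "x \<in> {1..n}" "y \<in> {1..n}" and less: "part S x < part S y" for x y
  proof -
    obtain s where "s \<in> S" "x \<le> s" "s < y" using less unfolding part_less_iff by blast
    thus ?thesis using sub xy unfolding cuts_def by force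
  qed
  thus "inflation n S id p" using p by (simp add: inflation_def)
qed

definition reversal :: "nat \<Rightarrow> nat \<Rightarrow> nat" where
  "reversal m i = (if i \<in> {1..m} then Suc m - i else i)"

lemma reversal_permutes: "reversal m permutes {1..m}"
proof (rule bij_imp_permutes)
  show "bij_betw (reversal m) {1..m} {1..m}"
    by (rule bij_betwI[where g = "reversal m"]) (auto simp: reversal_def)
qed (auto simp: reversal_def)

lemma inflation_reversal_iff:
  assumes p: "p permutes {1..n}" and S: "S \<subseteq> {1..<n}" "1 \<le> n"
  shows "inflation n S (reversal (Suc (card S))) p \<longleftrightarrow> S \<subseteq> cuts (>) n p"
proof -
  have part_in: "part S x \<in> {1..Suc (card S)}" if "x \<in> {1..n}" for x
    unfolding part_image[OF S, symmetric] using that by (rule imageI)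
  have rev_less: "reversal (Suc (card S)) (part S x) < reversal (Suc (card S)) (part S y) \<longleftrightarrow>
      part S y < part S x" if "x \<in> {1..n}" "y \<in> {1..n}" for x y
    using part_in[OF that(1)] part_in[OF that(2)] by (auto simp: reversal_def)
  show ?thesis
  proof
    assume infl: "inflation n S (reversal (Suc (card S))) p"
    show "S \<subseteq> cuts (>) n p"
    proof
      fix s assume s: "s \<in> S"
      hence s_in: "s \<in> {1..<n}" using S by blast
      have "p y < p x" if "x \<in> {1..s}" "y \<in> {Suc s..n}" for x y
      proof -
        have xy: "x \<le> s" "s < y" "x \<in> {1..n}" "y \<in> {1..n}" using that s_in by simp_all
        hence "part S x < part S y" unfolding part_less_iff using s by blast
        thus ?thesis using inflationD[OF infl xy(4,3)] rev_less[OF xy(4,3)] by blast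
      qed
      thus "s \<in> cuts (>) n p" using s_in unfolding cuts_def by blast
    qed
  next
    assume sub: "S \<subseteq> cuts (>) n p"
    have "p y < p x" if xy: "x \<in> {1..n}" "y \<in> {1..n}" and less: "part S x < part S y" for x y
    proof -
      obtain s where "s \<in> S" "x \<le> s" "s < y" using less unfolding part_less_iff by blast
      thus ?thesis using sub xy unfolding cuts_def by force
    qed
    thus "inflation n S (reversal (Suc (card S))) p"
      using p rev_less unfolding inflation_def by blast
  qed
qed

lemma alternating_sum_subsets:
  assumes "finite A"
  shows "(\<Sum>S\<in>Pow A. (-1) ^ card S) = (of_bool (A = {}) :: int)"
  using assms
proof (induction A rule: finite_induct)
  case (insert a A)
  have "(\<Sum>S\<in>Pow (insert a A). (-1) ^ card S) =
      (\<Sum>S\<in>Pow A. (-1) ^ card S) + (\<Sum>S\<in>insert a ` Pow A. (-1) ^ card S :: int)"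
    unfolding Pow_insert using insert.hyps by (intro sum.union_disjoint) auto
  also have "(\<Sum>S\<in>insert a ` Pow A. (-1) ^ card S :: int) = (\<Sum>S\<in>Pow A. (-1) ^ card (insert a S))"
    using insert.hyps by (subst sum.reindex) (auto simp: inj_on_def)
  also have "\<dots> = (\<Sum>S\<in>Pow A. - ((-1) ^ card S))"
  proof (rule sum.cong[OF refl])
    fix S assume "S \<in> Pow A"
    hence "finite S" "a \<notin> S" using insert.hyps finite_subset by auto
    thus "(-1) ^ card (insert a S) = (- ((-1) ^ card S) :: int)" by simp
  qed
  finally show ?case by (simp add: sum_negf)
qed simp

text \<open>
  The weight in an inclusion-exclusion over nonempty sets of size \<open>k\<close>; the value 0 at \<open>k = 0\<close> leaves
  out the empty set.
\<close>
definition nonempty_sign :: "nat \<Rightarrow> int" where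
  "nonempty_sign k = (if k = 0 then 0 else (-1) ^ Suc k)"

lemma sum_nonempty_sign_subsets:
  assumes "finite A"
  shows "(\<Sum>S\<in>Pow A. nonempty_sign (card S)) = of_bool (A \<noteq> {})"
proof -
  have "nonempty_sign (card S) = of_bool (S = {}) - (-1) ^ card S" if "S \<in> Pow A" for S
  proof -
    have "finite S" using that assms finite_subset by blast
    thus ?thesis by (auto simp: nonempty_sign_def)
  qed
  hence "(\<Sum>S\<in>Pow A. nonempty_sign (card S)) = (\<Sum>S\<in>Pow A. of_bool (S = {}) - (-1) ^ card S)"
    by (intro sum.cong refl)
  also have "\<dots> = (\<Sum>S\<in>Pow A. of_bool (S = {})) - of_bool (A = {})"
    by (simp only: sum_subtractf alternating_sum_subsets[OF assms])
  also have "(\<Sum>S\<in>Pow A. of_bool (S = {}) :: int) = 1"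
    unfolding of_bool_def using assms by simp
  finally show ?thesis by simp
qed

lemma sum_over_cut_sets:
  assumes "1 \<le> n"
  shows "(\<Sum>S\<in>Pow {1..<n}. f (card S) * int (class_weight n S)) =
    (\<Sum>m<n. f m * fps_nth (fact_fps ^ Suc m) n)"
proof -
  have card: "card ` Pow {1..<n} \<subseteq> {..<n}"
  proof
    fix c assume "c \<in> card ` Pow {1..<n}"
    then obtain S where "S \<subseteq> {1..<n}" "c = card S" by blast
    thus "c \<in> {..<n}" using card_mono[of "{1..<n}" S] assms by simp
  qed
  have "(\<Sum>m<n. f m * fps_nth (fact_fps ^ Suc m) n) =
      (\<Sum>m<n. \<Sum>S | S \<in> Pow {1..<n} \<and> card S = m. f (card S) * int (class_weight n S))"
    unfolding sum_class_weight[OF assms, symmetric] sum_distrib_left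
    by (intro sum.cong refl) auto
  also have "\<dots> = (\<Sum>S\<in>Pow {1..<n}. f (card S) * int (class_weight n S))"
    by (rule sum.group) (use card in auto)
  finally show ?thesis by simp
qed

lemma sum_swap_card:
  assumes "finite P" "finite D"
  shows "(\<Sum>p\<in>P. \<Sum>d | d \<in> D \<and> R d p. w d) = (\<Sum>d\<in>D. w d * int (card {p \<in> P. R d p}))"
proof -
  have "(\<Sum>p\<in>P. \<Sum>d | d \<in> D \<and> R d p. w d) = (\<Sum>p\<in>P. \<Sum>d\<in>D. if R d p then w d else 0)"
    using assms(2) by (intro sum.cong refl sum.inter_filter)
  also have "\<dots> = (\<Sum>d\<in>D. \<Sum>p\<in>P. if R d p then w d else 0)"
    by (rule sum.swap)
  also have "\<dots> = (\<Sum>d\<in>D. w d * int (card {p \<in> P. R d p}))"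
    using assms(1) by (intro sum.cong refl) (simp add: sum.inter_filter[symmetric])
  finally show ?thesis .
qed

text \<open>
  The sets along which \<open>p\<close> is an inflation of \<open>t\<close> are the subsets of its set of cuts, so their signs
  add up to 1 if there is a cut and to 0 otherwise. It remains to count, for each \<open>S\<close>, the inflations
  along \<open>S\<close>.
\<close>
lemma sum_has_cuts:
  assumes n: "1 \<le> n"
    and t: "\<And>S. S \<subseteq> {1..<n} \<Longrightarrow> t S permutes {1..Suc (card S)}"
    and iff: "\<And>S p. S \<subseteq> {1..<n} \<Longrightarrow> p permutes {1..n} \<Longrightarrow> inflation n S (t S) p \<longleftrightarrow> S \<subseteq> cuts R n p"
  shows "(\<Sum>p | p permutes {1..n}. of_bool (cuts R n p \<noteq> {})) =
    (\<Sum>m<n. nonempty_sign m * fps_nth (fact_fps ^ Suc m) n)"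
proof -
  have fin: "finite {p. p permutes {1..n}}" by (rule finite_permutations) simp
  have "(\<Sum>p | p permutes {1..n}. of_bool (cuts R n p \<noteq> {})) =
      (\<Sum>p | p permutes {1..n}. \<Sum>S | S \<in> Pow {1..<n} \<and> inflation n S (t S) p. nonempty_sign (card S))"
  proof (rule sum.cong[OF refl])
    fix p assume "p \<in> {p. p permutes {1..n}}"
    hence p: "p permutes {1..n}" by simp
    have sub: "cuts R n p \<subseteq> {1..<n}" by (auto simp: cuts_def)
    hence "{S. S \<in> Pow {1..<n} \<and> inflation n S (t S) p} = Pow (cuts R n p)"
      using iff[OF _ p] by blast
    thus "of_bool (cuts R n p \<noteq> {}) =
        (\<Sum>S | S \<in> Pow {1..<n} \<and> inflation n S (t S) p. nonempty_sign (card S))"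
      using sum_nonempty_sign_subsets[of "cuts R n p"] finite_subset[OF sub] by simp
  qed
  also have "\<dots> = (\<Sum>S\<in>Pow {1..<n}. nonempty_sign (card S) *
      int (card {p \<in> {p. p permutes {1..n}}. inflation n S (t S) p}))"
    using fin by (rule sum_swap_card) simp
  also have "\<dots> = (\<Sum>S\<in>Pow {1..<n}. nonempty_sign (card S) * int (class_weight n S))"
  proof (rule sum.cong[OF refl])
    fix S assume "S \<in> Pow {1..<n}"
    hence S: "S \<subseteq> {1..<n}" by simp
    have "{p \<in> {p. p permutes {1..n}}. inflation n S (t S) p} = {p. inflation n S (t S) p}"
      by (auto dest: inflation_permutes)
    thus "nonempty_sign (card S) * int (card {p \<in> {p. p permutes {1..n}}. inflation n S (t S) p}) =
        nonempty_sign (card S) * int (class_weight n S)"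
      using card_inflations[OF S n t[OF S]] by simp
  qed
  also have "\<dots> = (\<Sum>m<n. nonempty_sign m * fps_nth (fact_fps ^ Suc m) n)"
    by (rule sum_over_cut_sets[OF n])
  finally show ?thesis .
qed

lemma finite_simple_perms: "finite {t. simple_perm m t}"
  by (rule finite_subset[of _ "{t. t permutes {1..m}}"])
     (auto simp: simple_perm_def intro: finite_permutations)

lemma sum_simple_decompositions:
  assumes n: "1 \<le> n"
  shows "(\<Sum>p | p permutes {1..n}. int (card (simple_decompositions n p))) =
    (\<Sum>m<n. (if 2 \<le> m then int (num_simple (Suc m)) else 0) * fps_nth (fact_fps ^ Suc m) n)"
proof -
  define \<S> where "\<S> = {S \<in> Pow {1..<n}. 2 \<le> card S}"
  define D where "D = (SIGMA S:\<S>. {t. simple_perm (Suc (card S)) t})"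
  have fin: "finite {p. p permutes {1..n}}" by (rule finite_permutations) simp
  have fin\<S>: "finite \<S>" by (simp add: \<S>_def)
  have finD: "finite D" unfolding D_def using fin\<S> finite_simple_perms by (intro finite_SigmaI) auto
  have "(\<Sum>p | p permutes {1..n}. int (card (simple_decompositions n p))) =
      (\<Sum>p | p permutes {1..n}. \<Sum>d | d \<in> D \<and> inflation n (fst d) (snd d) p. 1)"
  proof (rule sum.cong[OF refl])
    fix p
    have "simple_decompositions n p = {d. d \<in> D \<and> inflation n (fst d) (snd d) p}"
      by (auto simp: simple_decompositions_def D_def \<S>_def)
    thus "int (card (simple_decompositions n p)) = (\<Sum>d | d \<in> D \<and> inflation n (fst d) (snd d) p. 1)"
      by simp
  qed
  also have "\<dots> = (\<Sum>d\<in>D. 1 * int (card {p \<in> {p. p permutes {1..n}}. inflation n (fst d) (snd d) p}))"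
    by (rule sum_swap_card[OF fin finD])
  also have "\<dots> = (\<Sum>(S, t)\<in>D. int (class_weight n S))"
  proof (rule sum.cong[OF refl])
    fix d assume d: "d \<in> D"
    obtain S t where St: "d = (S, t)" by (cases d)
    have S: "S \<subseteq> {1..<n}" and t: "t permutes {1..Suc (card S)}"
      using d St by (auto simp: D_def \<S>_def dest: simple_permutes)
    have "{p \<in> {p. p permutes {1..n}}. inflation n S t p} = {p. inflation n S t p}"
      by (auto dest: inflation_permutes)
    thus "1 * int (card {p \<in> {p. p permutes {1..n}}. inflation n (fst d) (snd d) p}) =
        (case d of (S, t) \<Rightarrow> int (class_weight n S))"
      using card_inflations[OF S n t] St by simp
  qed
  also have "\<dots> = (\<Sum>S\<in>\<S>. \<Sum>t | simple_perm (Suc (card S)) t. int (class_weight n S))"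
    unfolding D_def using fin\<S> finite_simple_perms by (intro sum.Sigma[symmetric]) auto
  also have "\<dots> = (\<Sum>S\<in>\<S>. int (num_simple (Suc (card S))) * int (class_weight n S))"
    by (simp add: num_simple_def)
  also have "\<dots> = (\<Sum>S\<in>Pow {1..<n}.
      (if 2 \<le> card S then int (num_simple (Suc (card S))) else 0) * int (class_weight n S))"
    unfolding \<S>_def by (intro sum.mono_neutral_cong_left) auto
  also have "\<dots> = (\<Sum>m<n. (if 2 \<le> m then int (num_simple (Suc m)) else 0) * fps_nth (fact_fps ^ Suc m) n)"
    by (rule sum_over_cut_sets[OF n])
  finally show ?thesis .
qed

text \<open>
  The coefficient belonging to inflations with \<open>m + 1\<close> parts. The value at \<open>m = 0\<close> accounts for
  \<open>n!\<close>, the coefficient of the first power of \<open>fact_fps\<close>; the factor 2 stands for direct and skew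
  sums.
\<close>
definition simple_coeff :: "nat \<Rightarrow> int" where
  "simple_coeff m = (if m = 0 then -1 else
     (if 2 \<le> m then int (num_simple (Suc m)) else 0) + 2 * (-1) ^ Suc m)"

text \<open>
  This is the trichotomy summed over all permutations, read as the statement that the series
  \<open>\<Sum>m. simple_coeff m * X^(m + 1)\<close> composed with \<open>fact_fps\<close> equals \<open>-X\<close>.
\<close>
lemma enumeration_identity:
  assumes "1 \<le> n"
  shows "(\<Sum>m<n. simple_coeff m * fps_nth (fact_fps ^ Suc m) n) = (if n = 1 then -1 else 0)"
proof (cases "n = 1")
  case True
  thus ?thesis by (simp add: simple_coeff_def fact_fps_def)
next
  case False
  hence n: "2 \<le> n" "1 \<le> n" using assms by simp_all
  let ?F = "\<lambda>m. fps_nth (fact_fps ^ Suc m) n"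
  have "fact n = (\<Sum>p | p permutes {1..n}. 1 :: int)"
    using card_permutations[of "{1..n}" n] by simp
  also have "\<dots> = (\<Sum>p | p permutes {1..n}. int (card (simple_decompositions n p)) +
      of_bool (cuts (<) n p \<noteq> {}) + of_bool (cuts (>) n p \<noteq> {}))"
  proof (rule sum.cong[OF refl])
    fix p assume "p \<in> {p. p permutes {1..n}}"
    hence "p permutes {1..n}" by simp
    from decomposition_trichotomy[OF this n(1)]
    have "int (card (simple_decompositions n p) + of_bool (cuts (<) n p \<noteq> {}) +
        of_bool (cuts (>) n p \<noteq> {})) = 1" by simp
    thus "1 = int (card (simple_decompositions n p)) +
        of_bool (cuts (<) n p \<noteq> {}) + of_bool (cuts (>) n p \<noteq> {})" by simp
  qed
  also have "\<dots> = (\<Sum>m<n. (if 2 \<le> m then int (num_simple (Suc m)) else 0) * ?F m) +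
      (\<Sum>m<n. nonempty_sign m * ?F m) + (\<Sum>m<n. nonempty_sign m * ?F m)"
  proof -
    have "(\<Sum>p | p permutes {1..n}. of_bool (cuts (<) n p \<noteq> {})) = (\<Sum>m<n. nonempty_sign m * ?F m)"
      by (rule sum_has_cuts[OF n(2), of "\<lambda>_. id"], rule permutes_id, rule inflation_id_iff)
    moreover have "(\<Sum>p | p permutes {1..n}. of_bool (cuts (>) n p \<noteq> {})) = (\<Sum>m<n. nonempty_sign m * ?F m)"
      by (rule sum_has_cuts[OF n(2), of "\<lambda>S. reversal (Suc (card S))"],
          rule reversal_permutes, rule inflation_reversal_iff[OF _ _ n(2)])
    ultimately show ?thesis
      by (simp only: sum.distrib sum_simple_decompositions[OF n(2)])
  qed
  also have "\<dots> = (\<Sum>m<n. simple_coeff m * ?F m + (if m = 0 then ?F 0 else 0))"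
    unfolding sum.distrib[symmetric]
    by (intro sum.cong refl) (auto simp: simple_coeff_def nonempty_sign_def algebra_simps)
  also have "\<dots> = (\<Sum>m<n. simple_coeff m * ?F m) + ?F 0"
    using n by (simp add: sum.distrib)
  also have "?F 0 = fact n" using n by (simp add: fact_fps_def)
  finally show ?thesis using False by simp
qed

section \<open>Catalan numbers and the composition inverse modulo 3\<close>

lemma catalan_Suc_mult: "(n + 1) * catalan n = (2 * n) choose n"
proof -
  have "real ((n + 1) * catalan n) = real ((2 * n) choose n)"
    using catalan_eq[of n] by (simp add: field_simps)
  thus ?thesis by (simp only: of_nat_eq_iff)
qed

lemma central_binomial_Suc:
  "Suc n * ((2 * Suc n) choose Suc n) = 2 * (2 * n + 1) * ((2 * n) choose n)"
proof -
  have "Suc n * ((2 * Suc n) choose Suc n) = (2 * Suc n) * (Suc (2 * n) choose n)"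
    using Suc_times_binomial[of n "Suc (2 * n)"] by simp
  also have "\<dots> = 2 * ((Suc (2 * n) - n) * (Suc (2 * n) choose n))"
    by (simp add: algebra_simps)
  also have "\<dots> = 2 * (Suc (2 * n) * ((2 * n) choose n))"
    by (simp only: binomial_absorb_comp diff_Suc_1)
  finally show ?thesis by simp
qed

definition catalan_fps :: "int fps" where
  "catalan_fps = Abs_fps (\<lambda>n. if n = 0 then 0 else int (catalan (n - 1)))"

text \<open>
  The derivative of the shifted Catalan series \<open>C\<close> is the series \<open>B\<close> of central binomial
  coefficients, whose recurrence is the equation \<open>(1 - 4X) B' = 2B\<close>. Comparing derivatives, this
  yields \<open>(1 - 4X) B = 1 - 2C\<close> and \<open>(1 - 4X) B^2 = 1\<close>, so that \<open>C - C^2\<close> has derivative 1.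
\<close>
lemma catalan_fps_quadratic: "catalan_fps - catalan_fps ^ 2 = fps_X"
proof -
  define C where "C = catalan_fps"
  define B :: "int fps" where "B = Abs_fps (\<lambda>n. int ((2 * n) choose n))"
  define L :: "int fps" where "L = 1 - fps_const 4 * fps_X"
  have C': "fps_deriv C = B"
  proof (rule fps_ext)
    fix n
    have "fps_nth (fps_deriv C) n = int ((n + 1) * catalan n)"
      by (simp add: C_def catalan_fps_def algebra_simps)
    thus "fps_nth (fps_deriv C) n = fps_nth B n"
      by (simp only: catalan_Suc_mult B_def fps_nth_Abs_fps)
  qed
  have L': "fps_deriv L = - fps_const 4" by (simp add: L_def)
  have B': "L * fps_deriv B = 2 * B"
  proof (rule fps_ext)
    fix n
    have rec: "int (n + 1) * fps_nth B (n + 1) = (4 * int n + 2) * fps_nth B n" for n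
    proof -
      have "int (Suc n * ((2 * Suc n) choose Suc n)) = int (2 * (2 * n + 1) * ((2 * n) choose n))"
        by (simp only: central_binomial_Suc)
      thus ?thesis by (simp add: B_def algebra_simps)
    qed
    have "fps_nth (L * fps_deriv B) n = fps_nth (fps_deriv B) n - 4 * fps_nth (fps_X * fps_deriv B) n"
      by (simp add: L_def left_diff_distrib mult.assoc)
    also have "fps_nth (fps_X * fps_deriv B) n = int n * fps_nth B n"
      by (cases n) simp_all
    also have "fps_nth (fps_deriv B) n = (4 * int n + 2) * fps_nth B n"
      using rec[of n] by simp
    finally show "fps_nth (L * fps_deriv B) n = fps_nth (2 * B) n"
      by (simp add: algebra_simps numeral_fps_const)
  qed
  have four: "fps_const 4 = (4 :: int fps)" by (simp add: numeral_fps_const)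
  have "fps_deriv (L * B) = fps_deriv (1 - 2 * C)"
    by (simp add: L' C' B' four)
  hence LB: "L * B = 1 - 2 * C"
    unfolding fps_deriv_eq_iff by (simp add: L_def B_def C_def catalan_fps_def fps_mult_nth_0)
  have "fps_deriv (L * B ^ 2) = 2 * B * (L * fps_deriv B) - 4 * B ^ 2"
    by (simp add: L' four power2_eq_square algebra_simps)
  also have "\<dots> = fps_deriv 1"
    by (simp add: B' power2_eq_square algebra_simps)
  finally have LB2: "L * B ^ 2 = 1"
    unfolding fps_deriv_eq_iff by (simp add: L_def B_def power2_eq_square fps_mult_nth_0)
  have "fps_deriv (C - C ^ 2) = B * (1 - 2 * C)"
    by (simp add: C' power2_eq_square algebra_simps)
  also have "\<dots> = B * (L * B)" by (simp only: LB)
  also have "\<dots> = fps_deriv fps_X"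
    using LB2 by (simp add: power2_eq_square mult.left_commute)
  finally have "C - C ^ 2 = fps_X"
    unfolding fps_deriv_eq_iff by (simp add: C_def catalan_fps_def power2_eq_square fps_mult_nth_0)
  thus ?thesis by (simp add: C_def)
qed

definition quad_fps :: "int fps" where
  "quad_fps = fps_X - fps_X ^ 2"

lemma quad_fps_nth_0: "fps_nth quad_fps 0 = 0" and quad_fps_nth_1: "fps_nth quad_fps 1 = 1"
  by (simp_all add: quad_fps_def fps_X_power_iff)

text \<open>
  For the composition \<open>H\<close> the quadratic equation gives \<open>H - H^2 = X - X^2\<close>, that is
  \<open>(H - X) (1 - H - X) = 0\<close>, and the second factor has constant term 1.
\<close>
lemma catalan_compose_quad: "fps_compose catalan_fps quad_fps = fps_X"
proof -
  define H where "H = fps_compose catalan_fps quad_fps"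
  note zero = quad_fps_nth_0
  have "H - H ^ 2 = fps_compose (catalan_fps - catalan_fps ^ 2) quad_fps"
    by (simp add: H_def fps_compose_sub_distrib fps_compose_power[OF zero])
  also have "\<dots> = fps_X - fps_X ^ 2"
    by (simp add: catalan_fps_quadratic fps_X_fps_compose_startby0[OF zero]) (simp add: quad_fps_def)
  finally have "(H - fps_X) * (1 - H - fps_X) = 0"
    by (simp add: algebra_simps power2_eq_square)
  moreover have "fps_nth (1 - H - fps_X) 0 = 1"
    by (simp add: H_def catalan_fps_def)
  hence "1 - H - fps_X \<noteq> 0" by (metis fps_zero_nth zero_neq_one)
  ultimately show ?thesis by (simp add: H_def)
qed

lemma sum_catalan_quad_power:
  assumes "1 \<le> n"
  shows "(\<Sum>m<n. int (catalan m) * fps_nth (quad_fps ^ Suc m) n) = (if n = 1 then 1 else 0)"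
proof -
  have "(\<Sum>m<n. int (catalan m) * fps_nth (quad_fps ^ Suc m) n) =
      (\<Sum>m\<in>{1..n}. fps_nth catalan_fps m * fps_nth (quad_fps ^ m) n)"
    by (rule sum.reindex_bij_witness[of _ "\<lambda>m. m - 1" Suc]) (auto simp: catalan_fps_def)
  also have "\<dots> = (\<Sum>m\<in>{0..n}. fps_nth catalan_fps m * fps_nth (quad_fps ^ m) n)"
    by (rule sum.mono_neutral_left) (auto simp: catalan_fps_def)
  also have "\<dots> = fps_nth (fps_compose catalan_fps quad_fps) n"
    by (simp only: fps_compose_nth)
  finally show ?thesis by (simp add: catalan_compose_quad)
qed

text \<open>
  The factorials from \<open>3!\<close> on are divisible by 3, and \<open>2! = 2\<close> is congruent to \<open>-1\<close>. The
  congruence passes to powers because \<open>x - y\<close> divides \<open>x^m - y^m\<close>.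
\<close>
lemma fact_fps_power_cong: "[fps_nth (fact_fps ^ m) n = fps_nth (quad_fps ^ m) n] (mod 3)"
proof -
  have "3 dvd fps_nth fact_fps k - fps_nth quad_fps k" for k
  proof (cases "3 \<le> k")
    case True
    hence "3 dvd (fact k :: int)" using dvd_fact[of 3 k] by (metis of_nat_dvd_iff of_nat_fact of_nat_numeral one_le_numeral)
    thus ?thesis using True by (simp add: fact_fps_def quad_fps_def fps_X_power_iff)
  next
    case False
    hence "k = 0 \<or> k = 1 \<or> k = 2" by linarith
    thus ?thesis by (auto simp: fact_fps_def quad_fps_def fps_X_power_iff)
  qed
  hence "\<forall>k. \<exists>c. fps_nth fact_fps k - fps_nth quad_fps k = 3 * c"
    by (auto elim: dvdE)
  from choice[OF this] obtain c where c: "\<And>k. fps_nth fact_fps k - fps_nth quad_fps k = 3 * c k"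
    by blast
  have "fact_fps - quad_fps = fps_const 3 * Abs_fps c"
    by (rule fps_ext) (simp add: c)
  moreover have "fact_fps - quad_fps dvd fact_fps ^ m - quad_fps ^ m"
    using diff_power_eq_sum[of fact_fps "m - 1" quad_fps] by (cases m) simp_all
  ultimately obtain H where "fact_fps ^ m - quad_fps ^ m = fps_const 3 * H"
    by (metis dvdE mult.assoc)
  hence "fps_nth (fact_fps ^ m - quad_fps ^ m) n = 3 * fps_nth H n" by simp
  hence "3 dvd fps_nth (fact_fps ^ m) n - fps_nth (quad_fps ^ m) n" by simp
  thus ?thesis by (simp add: cong_iff_dvd_diff)
qed

text \<open>
  Modulo 3 the series with coefficients \<open>simple_coeff m + catalan m\<close> vanishes after composition with
  \<open>X - X^2\<close>. This is a triangular system with ones on the diagonal, so all coefficients vanish.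
\<close>
lemma simple_coeff_cong: "3 dvd simple_coeff m + int (catalan m)"
proof (induction m rule: less_induct)
  case (less m)
  let ?d = "\<lambda>j. simple_coeff j + int (catalan j)"
  let ?G = "\<lambda>j. fps_nth (quad_fps ^ Suc j) (Suc m)"
  have "[(\<Sum>j<Suc m. simple_coeff j * fps_nth (fact_fps ^ Suc j) (Suc m)) =
      (\<Sum>j<Suc m. simple_coeff j * ?G j)] (mod 3)"
    by (intro cong_sum cong_scalar_left fact_fps_power_cong)
  hence "[(\<Sum>j<Suc m. simple_coeff j * ?G j) + (\<Sum>j<Suc m. int (catalan j) * ?G j) =
      (\<Sum>j<Suc m. simple_coeff j * fps_nth (fact_fps ^ Suc j) (Suc m)) +
      (\<Sum>j<Suc m. int (catalan j) * ?G j)] (mod 3)"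
    by (intro cong_add cong_refl) (rule cong_sym)
  also have "(\<Sum>j<Suc m. simple_coeff j * fps_nth (fact_fps ^ Suc j) (Suc m)) +
      (\<Sum>j<Suc m. int (catalan j) * ?G j) = 0"
    by (subst enumeration_identity, simp, subst sum_catalan_quad_power) simp_all
  finally have "[(\<Sum>j<Suc m. simple_coeff j * ?G j) + (\<Sum>j<Suc m. int (catalan j) * ?G j) = 0] (mod 3)" .
  hence "3 dvd (\<Sum>j<Suc m. ?d j * ?G j)"
    by (simp only: cong_0_iff sum.distrib[symmetric] distrib_right)
  hence "3 dvd (\<Sum>j<m. ?d j * ?G j) + ?d m * ?G m" by simp
  moreover have "3 dvd (\<Sum>j<m. ?d j * ?G j)"
    using less.IH by (intro dvd_sum) auto
  ultimately have "3 dvd ?d m * ?G m" by (simp only: dvd_add_right_iff)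
  moreover have "?G m = 1"
    by (simp only: startsby_zero_power_nth_same[OF quad_fps_nth_0] quad_fps_nth_1 power_one)
  ultimately show ?case by simp
qed

theorem corollary14:
  fixes n :: nat
  assumes "n > 2"
  shows "[int (num_simple n) = - int (catalan (n - 1)) + (-1) ^ n] (mod 3)"
proof -
  have "Suc (n - 1) = n" "2 \<le> n - 1" using assms by simp_all
  hence "simple_coeff (n - 1) = int (num_simple n) + 2 * (-1) ^ n"
    unfolding simple_coeff_def by simp
  \<comment> \<open>Subtracting a multiple of 3 turns the summand with factor 2 into one with factor -1.\<close>
  hence "3 dvd (int (num_simple n) + 2 * (-1) ^ n + int (catalan (n - 1))) - 3 * (-1) ^ n"
    using simple_coeff_cong[of "n - 1"] by (intro dvd_diff) simp_all
  thus ?thesis by (simp add: cong_iff_dvd_diff algebra_simps)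
qed

end
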